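(* Let $M$ be an $n\times n$ matrix whose entries are assigned colors, such that each color appears at most $\Delta$ times, where $\Delta\le\frac{27}{256}n$. Let $w:[n]\times[n]\to\mathbb R_{\ge0}$ be a weighting function and $W=\sum_{x,y}w(x,y)$. Then the Swapping Algorithm finds a Latin transversal $T$ of $M$ with probability one, and $$\mathbf E_{\mathrm{MT}}[w(T)]\ \le\ \tfrac53\,W/n,\qquad\text{where } w(T)=\sum_{(x,y)\in T}w(x,y).$$
   Context: $[n]=\{1,\dots,n\}$. A Latin transversal of $M$ is a selection of $n$ cells, one from each row and one from each column, such that no color is selected more than once. A permutation $\pi\in S_n$ corresponds to the selection $T=\{(x,\pi(x)):x\in[n]\}$. Swapping Algorithm: the bad-events are the events $\pi(i)=j\wedge\pi(i')=j'$, one for each unordered pair of distinct cells $(i,j),(i',j')$ with $i\neq i'$, $j\ne j'$ of the same color in $M$. Draw $\pi\in S_n$ uniformly at random; while some bad-event is true on $\pi$, choose a true bad-event $\pi(x_1)=y_1\wedge\pi(x_2)=y_2$ (by an arbitrary fixed, possibly randomized, rule); swap the values of $\pi$ at positions $x_1$ and $x_1'$ with $x_1'$ uniform on $[n]$, and then swap the values of $\pi$ at positions $x_2$ and $x_2'$ with $x_2'$ uniform on $[n]\setminus\{x_1\}$. $\mathbf E_{\mathrm{MT}}$ is expectation with respect to the distribution of the selection $T$ at termination. The result holds for every choice of selection rule. *)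

theory Defs
  imports "HOL-Probability.Probability" "HOL-Combinatorics.Transposition"
begin

type_synonym cell = "nat \<times> nat"

text \<open>
  The grid \<open>[n] \<times> [n]\<close> is \<open>{1..n} \<times> {1..n}\<close>. A coloured matrix is a function
  \<open>M :: nat \<Rightarrow> nat \<Rightarrow> 'c\<close>, and a permutation of \<open>[n]\<close> a function that \<open>permutes {1..n}\<close>;
  values of \<open>M\<close> outside the grid play no role.
\<close>

definition color_class :: "nat \<Rightarrow> (nat \<Rightarrow> nat \<Rightarrow> 'c) \<Rightarrow> 'c \<Rightarrow> cell set" where
  "color_class n M c = {(x, y) \<in> {1..n} \<times> {1..n}. M x y = c}"

definition latin_transversal :: "nat \<Rightarrow> (nat \<Rightarrow> nat \<Rightarrow> 'c) \<Rightarrow> cell set \<Rightarrow> bool" where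
  "latin_transversal n M T \<longleftrightarrow>
     T \<subseteq> {1..n} \<times> {1..n} \<and>
     (\<forall>x\<in>{1..n}. \<exists>!y. (x, y) \<in> T) \<and>
     (\<forall>y\<in>{1..n}. \<exists>!x. (x, y) \<in> T) \<and>
     inj_on (\<lambda>(x, y). M x y) T"

definition selection :: "nat \<Rightarrow> (nat \<Rightarrow> nat) \<Rightarrow> cell set" where
  "selection n \<pi> = {(x, \<pi> x) | x. x \<in> {1..n}}"

definition weight :: "(nat \<Rightarrow> nat \<Rightarrow> real) \<Rightarrow> cell set \<Rightarrow> real" where
  "weight w T = (\<Sum>(x, y)\<in>T. w x y)"

text \<open>
  A bad-event is an unordered pair of cells. It is represented here by its two ordered versions;
  the order says which of the two cells is resampled first.
\<close>

type_synonym event = "cell \<times> cell"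

definition bad_events :: "nat \<Rightarrow> (nat \<Rightarrow> nat \<Rightarrow> 'c) \<Rightarrow> event set" where
  "bad_events n M =
     {((i, j), (i', j')) | i j i' j'.
        i \<in> {1..n} \<and> j \<in> {1..n} \<and> i' \<in> {1..n} \<and> j' \<in> {1..n} \<and>
        i \<noteq> i' \<and> j \<noteq> j' \<and> M i j = M i' j'}"

definition holds_on :: "(nat \<Rightarrow> nat) \<Rightarrow> event \<Rightarrow> bool" where
  "holds_on \<pi> = (\<lambda>((i, j), (i', j')). \<pi> i = j \<and> \<pi> i' = j')"

definition true_bad_events :: "nat \<Rightarrow> (nat \<Rightarrow> nat \<Rightarrow> 'c) \<Rightarrow> (nat \<Rightarrow> nat) \<Rightarrow> event set" where
  "true_bad_events n M \<pi> = {B \<in> bad_events n M. holds_on \<pi> B}"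

definition swap_values :: "(nat \<Rightarrow> nat) \<Rightarrow> nat \<Rightarrow> nat \<Rightarrow> (nat \<Rightarrow> nat)" where
  "swap_values \<pi> x x' = \<pi> \<circ> Transposition.transpose x x'"

text \<open>
  A history lists the permutations seen at the earlier steps together with the events that were
  resampled there, most recent first. The positions \<open>x\<^sub>1'\<close> and \<open>x\<^sub>2'\<close> drawn at a step
  can be read off from the permutations before and after it, so the history together with the
  current permutation determines everything that has happened so far. A selection rule is a
  distribution over events that may depend on all of this.
\<close>

type_synonym history = "((nat \<Rightarrow> nat) \<times> event) list"

type_synonym rule = "history \<Rightarrow> (nat \<Rightarrow> nat) \<Rightarrow> event pmf"

definition selection_rule :: "nat \<Rightarrow> (nat \<Rightarrow> nat \<Rightarrow> 'c) \<Rightarrow> rule \<Rightarrow> bool" where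
  "selection_rule n M R \<longleftrightarrow>
     (\<forall>h \<pi>. \<pi> permutes {1..n} \<longrightarrow> true_bad_events n M \<pi> \<noteq> {} \<longrightarrow>
        set_pmf (R h \<pi>) \<subseteq> true_bad_events n M \<pi>)"

definition resample :: "nat \<Rightarrow> event \<Rightarrow> (nat \<Rightarrow> nat) \<Rightarrow> (nat \<Rightarrow> nat) spmf" where
  "resample n = (\<lambda>((x\<^sub>1, y\<^sub>1), (x\<^sub>2, y\<^sub>2)) \<pi>. do {
     x\<^sub>1' \<leftarrow> spmf_of_set {1..n};
     let \<pi>' = swap_values \<pi> x\<^sub>1 x\<^sub>1';
     x\<^sub>2' \<leftarrow> spmf_of_set ({1..n} - {x\<^sub>1});
     return_spmf (swap_values \<pi>' x\<^sub>2 x\<^sub>2')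
   })"

text \<open>
  The while loop is the least fixed point in the order of subprobability mass functions, so the
  mass missing from \<open>swapping_loop n M R h \<pi>\<close> is the probability of non-termination.
\<close>

partial_function (spmf) swapping_loop ::
    "nat \<Rightarrow> (nat \<Rightarrow> nat \<Rightarrow> 'c) \<Rightarrow> rule \<Rightarrow> history \<Rightarrow> (nat \<Rightarrow> nat) \<Rightarrow> (nat \<Rightarrow> nat) spmf" where
  "swapping_loop n M R h \<pi> =
     (if true_bad_events n M \<pi> = {} then return_spmf \<pi>
      else do {
        B \<leftarrow> spmf_of_pmf (R h \<pi>);
        \<pi>' \<leftarrow> resample n B \<pi>;
        swapping_loop n M R ((\<pi>, B) # h) \<pi>'
      })"

definition swapping_algorithm ::
    "nat \<Rightarrow> (nat \<Rightarrow> nat \<Rightarrow> 'c) \<Rightarrow> rule \<Rightarrow> cell set spmf" where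
  "swapping_algorithm n M R = do {
     \<pi>\<^sub>0 \<leftarrow> spmf_of_set {\<pi>. \<pi> permutes {1..n}};
     \<pi> \<leftarrow> swapping_loop n M R [] \<pi>\<^sub>0;
     return_spmf (selection n \<pi>)
   }"

text \<open>
  Expectation over the output of the algorithm. Only finitely many selections have positive
  probability, so every function is integrable here, and when the algorithm terminates
  almost surely this is an expectation with respect to a probability measure.
\<close>

definition expectation_MT ::
    "nat \<Rightarrow> (nat \<Rightarrow> nat \<Rightarrow> 'c) \<Rightarrow> rule \<Rightarrow> (cell set \<Rightarrow> real) \<Rightarrow> real" where
  "expectation_MT n M R f = (\<integral>T. f T \<partial>measure_spmf (swapping_algorithm n M R))"

end

(*
  Let A_B be the operator that resamples a true bad event B. These operators preserve the uniform
  measure up to the factor P(B), and A_B and A_C commute when B and C share no row or column,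
  because up to a constant A_B is the product of the two single-cell resampling operators. Summing
  A_H 1 over all traces H (words in the bad events modulo this commutation) whose only final letter
  is B gives a function G_B of the current permutation that drops by at least one whenever B is
  resampled and does not increase in expectation when another event is. So the expected number of
  resamplings of B is at most the uniform mean of G_B, and the usual cluster expansion count bounds
  that by (256/81) P(B). Hence the algorithm stops almost surely, whatever the selection rule.
  A cell (x, y) is selected at the end only if it was selected at the start or became selected when
  an event meeting row x or column y was resampled, which happens with probability at most 1/n each
  time. Those events have total weight at most 1/3 per row and column, so the cell is selected with
  probability at most (1 + 1/3 + 1/3) / n.
*)

theory Submission
  imports Defs
begin

section \<open>The potential of a commuting family of resampling operators\<close>

text \<open>
  The factor \<open>256/81\<close> is \<open>(1 + 1/3)\<^sup>4\<close>, with one factor \<open>1 + 1/3\<close> for each line of an event.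
\<close>

locale commuting_resampling =
  fixes E :: "'b set" and lines :: "'b \<Rightarrow> 'l set"
    and A :: "'b \<Rightarrow> ('s \<Rightarrow> ennreal) \<Rightarrow> ('s \<Rightarrow> ennreal)"
    and S :: "'s set" and p :: real
  assumes finite_E: "finite E"
    and lines_nonempty: "\<And>B. B \<in> E \<Longrightarrow> lines B \<noteq> {}"
    and finite_lines: "\<And>B. B \<in> E \<Longrightarrow> finite (lines B)"
    and card_lines: "\<And>B. B \<in> E \<Longrightarrow> card (lines B) \<le> 4"
    and A_commute: "\<And>B C f. B \<in> E \<Longrightarrow> C \<in> E \<Longrightarrow> disjnt (lines B) (lines C) \<Longrightarrow>
        A B (A C f) = A C (A B f)"
    and A_mono: "\<And>B f g. f \<le> g \<Longrightarrow> A B f \<le> A B g"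
    and A_nn_integral: "\<And>B (X :: 'b set list set) F s.
        A B (\<lambda>s. \<integral>\<^sup>+ r. F r s \<partial>count_space X) s = (\<integral>\<^sup>+ r. A B (F r) s \<partial>count_space X)"
    and A_one: "\<And>B. B \<in> E \<Longrightarrow> A B (\<lambda>_. 1) \<le> (\<lambda>_. 1)"
    and A_sum: "\<And>B f. B \<in> E \<Longrightarrow> (\<Sum>s\<in>S. A B f s) = ennreal p * (\<Sum>s\<in>S. f s)"
    and p_nonneg: "0 \<le> p"
    and line_weight: "\<And>l. 256 / 81 * p * card {B \<in> E. l \<in> lines B} \<le> 1 / 3"
begin

section \<open>Traces in layered normal form and their operators\<close>

definition meets :: "'b set \<Rightarrow> 'b \<Rightarrow> bool" where
  "meets I B \<longleftrightarrow> (\<exists>C\<in>I. \<not> disjnt (lines B) (lines C))"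

definition stable :: "'b set \<Rightarrow> bool" where
  "stable I \<longleftrightarrow> I \<subseteq> E \<and> pairwise (\<lambda>B C. disjnt (lines B) (lines C)) I"

text \<open>Cartier-Foata normal form of a trace, read backwards from its final letters
  \<open>J\<close>: the letters of a layer commute, and each depends on some letter of the layer
  preceding it in the list. So \<open>layered {B} r\<close> enumerates the traces whose only final
  letter is \<open>B\<close>.\<close>

fun layered :: "'b set \<Rightarrow> 'b set list \<Rightarrow> bool" where
  "layered J [] = True"
| "layered J (I # r) = (I \<noteq> {} \<and> stable I \<and> (\<forall>B\<in>I. meets J B) \<and> layered I r)"

text \<open>
  In the trace monoid, where disjoint events commute, adding \<open>C\<close> on the far side of a layered
  sequence puts it just beyond the last layer that it meets.
\<close>

fun add_event :: "'b \<Rightarrow> 'b set list \<Rightarrow> 'b set list" where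
  "add_event C [] = [{C}]"
| "add_event C (I # r) =
    (if \<exists>J\<in>set (I # r). meets J C then I # add_event C r else insert C I # r)"

text \<open>Left inverse of \<open>add_event C\<close> on layered sequences; it provides the
  injectivity behind \<open>potential_superharmonic\<close>.\<close>

fun remove_event :: "'b \<Rightarrow> 'b set list \<Rightarrow> 'b set list" where
  "remove_event C [] = []"
| "remove_event C (I # r) =
    (if \<exists>J\<in>set r. C \<in> J then I # remove_event C r
     else if I = {C} then r else (I - {C}) # r)"

text \<open>The product of the operators of a layer. On a stable set they commute, so no order has
  to be chosen.\<close>

definition A_layer :: "'b set \<Rightarrow> ('s \<Rightarrow> ennreal) \<Rightarrow> ('s \<Rightarrow> ennreal)" where
  "A_layer I f = Finite_Set.fold A f I"

text \<open>The head layer, closest to the final letter, acts innermost; operators further out stand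
  for earlier resamplings.\<close>

fun A_layers :: "'b set list \<Rightarrow> ('s \<Rightarrow> ennreal) \<Rightarrow> ('s \<Rightarrow> ennreal)" where
  "A_layers [] f = f"
| "A_layers (I # r) f = A_layers r (A_layer I f)"

text \<open>The function \<open>G_B\<close> of the overview. Values in \<open>ennreal\<close> allow
  the infinite sum before its convergence is known.\<close>

definition potential :: "'b \<Rightarrow> 's \<Rightarrow> ennreal" where
  "potential B s = (\<integral>\<^sup>+ r. A_layers r (A B (\<lambda>_. 1)) s \<partial>count_space {r. layered {B} r})"

lemma meets_self: "C \<in> E \<Longrightarrow> C \<in> I \<Longrightarrow> meets I C"
  using lines_nonempty unfolding meets_def disjnt_def by (intro bexI[of _ C]) simp_all

lemma meets_mono: "meets I C \<Longrightarrow> I \<subseteq> J \<Longrightarrow> meets J C"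
  by (auto simp: meets_def)

lemma stable_finite: "stable I \<Longrightarrow> finite I"
  using finite_E finite_subset by (auto simp: stable_def)

lemma stable_insert: "stable I \<Longrightarrow> C \<in> E \<Longrightarrow> \<not> meets I C \<Longrightarrow> stable (insert C I)"
  by (auto simp: stable_def pairwise_insert meets_def disjnt_sym)

lemma layered_mono: "layered J r \<Longrightarrow> J \<subseteq> J' \<Longrightarrow> layered J' r"
  by (cases r) (auto intro: meets_mono)

text \<open>The list \<open>J # r\<close> is the right one to test: an event that meets
  \<open>J\<close> but no layer of \<open>r\<close> enters the first layer.\<close>

lemma layered_add_event:
  assumes "layered J r" "C \<in> E" "\<exists>I\<in>set (J # r). meets I C"
  shows "layered J (add_event C r)"
  using assms
proof (induction r arbitrary: J)
  case Nil
  then show ?case by (simp add: stable_def)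
next
  case (Cons I r)
  show ?case
  proof (cases "\<exists>J\<in>set (I # r). meets J C")
    case True
    then show ?thesis using Cons by auto
  next
    case False
    then show ?thesis
      using Cons.prems by (auto intro: stable_insert layered_mono)
  qed
qed

lemma add_event_mem: "\<exists>I\<in>set (add_event C r). C \<in> I"
  by (induction r) auto

text \<open>\<open>C\<close> meets every layer that contains it and is put beyond the last layer it
  meets, so the added copy is the last occurrence of \<open>C\<close>.\<close>

lemma remove_add_event:
  assumes "layered J r" "C \<in> E"
  shows "remove_event C (add_event C r) = r"
  using assms
proof (induction r arbitrary: J)
  case Nil
  then show ?case by simp
next
  case (Cons I r)
  show ?case
  proof (cases "\<exists>J\<in>set (I # r). meets J C")
    case True
    then show ?thesis using Cons add_event_mem[of C r] by auto
  next
    case False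
    then have "C \<notin> I" "\<forall>J\<in>set r. C \<notin> J"
      using meets_self Cons.prems by auto
    then show ?thesis using False Cons.prems by auto
  qed
qed

lemma comp_fun_commute_A:
  assumes "stable I" shows "comp_fun_commute_on I A"
proof
  fix B C assume "B \<in> I" "C \<in> I"
  then show "A C \<circ> A B = A B \<circ> A C"
    using assms A_commute[of C B] by (cases "B = C") (simp_all add: fun_eq_iff stable_def pairwise_def subset_iff)
qed

lemma A_layer_insert:
  assumes "stable I" "C \<in> E" "\<not> meets I C"
  shows "A_layer (insert C I) f = A C (A_layer I f)"
    and "A C (A_layer I f) = A_layer I (A C f)"
proof -
  interpret comp_fun_commute_on "insert C I" A
    using assms by (intro comp_fun_commute_A stable_insert)
  have "C \<notin> I" using meets_self assms by auto
  then show "A_layer (insert C I) f = A C (A_layer I f)"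
    using fold_insert[of C I f] stable_finite[OF assms(1)] by (simp add: A_layer_def)
  show "A C (A_layer I f) = A_layer I (A C f)"
    using fold_fun_left_comm[of C I f] stable_finite[OF assms(1)] by (auto simp: A_layer_def)
qed

lemma A_layers_commute:
  assumes "layered J r" "C \<in> E" "\<not> (\<exists>I\<in>set r. meets I C)"
  shows "A C (A_layers r f) = A_layers r (A C f)"
  using assms A_layer_insert(2)
  by (induction r arbitrary: J f) auto

text \<open>\<open>A C\<close> slides inward past the layers that \<open>C\<close> does not meet,
  until it reaches the layer where \<open>add_event\<close> puts it.\<close>

lemma A_layers_add_event:
  assumes "layered J r" "C \<in> E"
  shows "A_layers (add_event C r) f = A C (A_layers r f)"
  using assms
proof (induction r arbitrary: J f)
  case Nil
  have "stable {}" "\<not> meets {} C" by (auto simp: stable_def meets_def)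
  from A_layer_insert(1)[OF this(1) Nil(2) this(2), of f] show ?case
    by (simp add: A_layer_def)
next
  case (Cons I r)
  show ?case
  proof (cases "\<exists>J\<in>set (I # r). meets J C")
    case True
    then show ?thesis using Cons by auto
  next
    case False
    then show ?thesis
      using Cons.prems A_layers_commute[of I r C] A_layer_insert(1)[of I C f] by auto
  qed
qed

lemma A_layer_mono:
  assumes "stable I" "f \<le> g"
  shows "A_layer I f \<le> A_layer I g"
proof -
  have "finite I" by (rule stable_finite[OF assms(1)])
  then show ?thesis using assms(1)
  proof (induction I)
    case empty
    then show ?case using assms(2) by (simp add: A_layer_def)
  next
    case (insert C I)
    then have "stable I" "C \<in> E" "\<not> meets I C"
      by (auto simp: stable_def pairwise_insert meets_def disjnt_sym)
    then show ?case using insert A_mono by (simp add: A_layer_insert(1))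
  qed
qed

lemma A_layers_mono: "layered J r \<Longrightarrow> f \<le> g \<Longrightarrow> A_layers r f \<le> A_layers r g"
  using A_layer_mono by (induction r arbitrary: J f g) auto

lemma A_layer_sum:
  assumes "stable I"
  shows "(\<Sum>s\<in>S. A_layer I f s) = ennreal (p ^ card I) * (\<Sum>s\<in>S. f s)"
proof -
  have "finite I" by (rule stable_finite[OF assms(1)])
  then show ?thesis using assms(1)
  proof (induction I)
    case empty
    then show ?case by (simp add: A_layer_def)
  next
    case (insert C I)
    then have "stable I" "C \<in> E" "\<not> meets I C"
      by (auto simp: stable_def pairwise_insert meets_def disjnt_sym)
    then show ?case using insert
      by (simp add: A_layer_insert(1) A_sum ennreal_mult p_nonneg mult.assoc)
  qed
qed

abbreviation total :: "'b set list \<Rightarrow> nat" where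
  "total r \<equiv> sum_list (map card r)"

lemma A_layers_sum:
  "layered J r \<Longrightarrow> (\<Sum>s\<in>S. A_layers r f s) = ennreal (p ^ total r) * (\<Sum>s\<in>S. f s)"
  by (induction r arbitrary: J f)
    (auto simp: A_layer_sum power_add ennreal_mult p_nonneg mult_ac)

text \<open>Adding \<open>C\<close> to the traces that it depends on maps the index set injectively
  into itself, and \<open>A C\<close> turns the term of a trace into the term of its image. On the
  other traces \<open>A C\<close> does not increase the term.\<close>

lemma potential_superharmonic:
  assumes B: "B \<in> E" and C: "C \<in> E"
  shows "A C (potential B) s + (if C = B then A B (\<lambda>_. 1) s else 0) \<le> potential B s"
proof -
  let ?V = "{r. layered {B} r}"
  let ?g = "\<lambda>r. A_layers r (A B (\<lambda>_. 1)) s"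
  define hit where "hit r \<longleftrightarrow> (\<exists>I\<in>set ({B} # r). meets I C)" for r
  define ins where "ins r = (if hit r then add_event C r else r)" for r
  have ins_V: "ins r \<in> ?V" if "r \<in> ?V" for r
    using that layered_add_event[of "{B}" r C] C by (auto simp: ins_def hit_def)
  have mem_hit: "hit r" if "\<exists>I\<in>set ({B} # r). C \<in> I" for r
    using that meets_self[OF C] unfolding hit_def by blast
  have inj: "inj_on ins ?V"
  proof (rule inj_onI)
    fix r r' assume r: "r \<in> ?V" "r' \<in> ?V" and eq: "ins r = ins r'"
    \<comment> \<open>Whether \<open>C\<close> was added can be read off from the result, so hit and
      unhit traces have different images.\<close>
    have hit_iff: "hit t \<longleftrightarrow> (\<exists>I\<in>set ({B} # ins t). C \<in> I)" for t
      using mem_hit[of t] add_event_mem[of C t] by (auto simp: ins_def)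
    have "hit r \<longleftrightarrow> hit r'" using eq hit_iff by simp
    then show "r = r'"
    proof (cases "hit r")
      case True
      then have "add_event C r = add_event C r'" using eq \<open>hit r \<longleftrightarrow> hit r'\<close> by (simp add: ins_def)
      then show ?thesis
        using remove_add_event r C by (metis mem_Collect_eq)
    qed (use eq in \<open>simp add: ins_def\<close>)
  qed
  have le: "A C (A_layers r (A B (\<lambda>_. 1))) s \<le> ?g (ins r)" if "r \<in> ?V" for r
  proof (cases "hit r")
    case True
    then show ?thesis using that A_layers_add_event[of "{B}" r C] C by (simp add: ins_def)
  next
    case False
    then have "disjnt (lines C) (lines B)" and no: "\<not> (\<exists>I\<in>set r. meets I C)"
      by (auto simp: hit_def meets_def)
    \<comment> \<open>Being independent of the whole trace and of \<open>B\<close>,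
      \<open>A C\<close> moves through to the constant 1, where \<open>A_one\<close> absorbs
      it.\<close>
    then have "A C (A_layers r (A B (\<lambda>_. 1))) = A_layers r (A B (A C (\<lambda>_. 1)))"
      using A_layers_commute[of "{B}" r C] A_commute[OF C B] that C by simp
    also have "\<dots> \<le> A_layers r (A B (\<lambda>_. 1))"
      using that by (intro A_layers_mono A_mono A_one C) simp
    finally show ?thesis using False by (simp add: ins_def le_fun_def)
  qed
  \<comment> \<open>For \<open>C = B\<close> every trace is hit and its image is nonempty. The term
    of the empty trace, which is \<open>A B (\<lambda>_. 1) s\<close>, is thus left over and
    accounts for the drop.\<close>
  have nil: "[] \<notin> ins ` ?V" if "C = B"
  proof
    assume "[] \<in> ins ` ?V"
    then obtain r where r: "ins r = []" by (metis imageE)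
    have "hit r" using mem_hit[of r] that by simp
    then show False using r add_event_mem[of C r] by (simp add: ins_def)
  qed
  let ?d = "if C = B then A B (\<lambda>_. 1) s else 0"
  have "A C (potential B) s = (\<integral>\<^sup>+ r. A C (A_layers r (A B (\<lambda>_. 1))) s \<partial>count_space ?V)"
    unfolding potential_def by (rule A_nn_integral)
  also have "\<dots> \<le> (\<integral>\<^sup>+ r. ?g (ins r) \<partial>count_space ?V)"
    by (rule nn_integral_mono) (use le in simp)
  also have "\<dots> = (\<integral>\<^sup>+ r. ?g r \<partial>count_space (ins ` ?V))"
    using inj by (intro nn_integral_bij_count_space) (simp add: bij_betw_def)
  also have "\<dots> = (\<integral>\<^sup>+ r. ?g r * indicator (ins ` ?V) r \<partial>count_space ?V)"
    by (subst nn_integral_count_space_indicator, use ins_V in force,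
        subst (2) nn_integral_count_space_indicator, use ins_V in force)
      (use ins_V in \<open>auto intro!: nn_integral_cong split: split_indicator\<close>)
  finally have "A C (potential B) s + ?d \<le>
      (\<integral>\<^sup>+ r. ?g r * indicator (ins ` ?V) r \<partial>count_space ?V) +
      (\<integral>\<^sup>+ r. ?d * indicator {[]} r \<partial>count_space ?V)"
    by (subst nn_integral_cmult_indicator) (auto simp: add_mono)
  also have "\<dots> = (\<integral>\<^sup>+ r. ?g r * indicator (ins ` ?V) r + ?d * indicator {[]} r \<partial>count_space ?V)"
    by (rule nn_integral_add[symmetric]) auto
  also have "\<dots> \<le> (\<integral>\<^sup>+ r. ?g r \<partial>count_space ?V)"
    using nil by (intro nn_integral_mono) (auto split: split_indicator)
  finally show ?thesis by (simp add: potential_def)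
qed

section \<open>Cluster expansion count of traces\<close>

definition stable_on :: "'l set \<Rightarrow> 'b set set" where
  "stable_on L = {I. stable I \<and> (\<forall>B\<in>I. \<not> disjnt (lines B) L)}"

lemma finite_stable_on: "finite (stable_on L)"
  by (rule finite_subset[of _ "Pow E"]) (auto simp: stable_on_def stable_def finite_E)

text \<open>
  The events through a given line are pairwise dependent, so a stable set contains at most one
  of them.
\<close>

lemma sum_stable_on:
  assumes "finite L"
  shows "(\<Sum>I\<in>stable_on L. (256 / 81 * p) ^ card I) \<le> (4 / 3) ^ card L"
  using assms
proof (induction L)
  case empty
  have "stable_on {} = {{}}" by (auto simp: stable_on_def stable_def)
  then show ?case by simp
next
  case (insert l L)
  let ?a = "256 / 81 * p"
  define K where "K = {B \<in> E. l \<in> lines B}"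
  define T where "T = insert {} ((\<lambda>B. {B}) ` K)"
  \<comment> \<open>Cutting \<open>I\<close> into the events through \<open>l\<close> and the rest,
    which touch \<open>L\<close>, bounds the sum by a product. The new factor
    \<open>1 + ?a * card K\<close> is at most \<open>4 / 3\<close> by
    \<open>line_weight\<close>.\<close>
  let ?h = "\<lambda>I. (I \<inter> K, I - K)"
  have finK: "finite K" using finite_E by (simp add: K_def)
  have a: "0 \<le> ?a" using p_nonneg by simp
  have inj: "inj_on ?h (stable_on (insert l L))" by (rule inj_onI) blast
  have card: "?a ^ card I = ?a ^ card (I \<inter> K) * ?a ^ card (I - K)"
    if "I \<in> stable_on (insert l L)" for I
  proof -
    have "finite I" using that stable_finite by (auto simp: stable_on_def)
    then have "card I = card (I \<inter> K) + card (I - K)"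
      by (metis card_Un_disjoint Diff_disjoint Int_Diff Int_Diff_Un Int_Diff_disjoint
          finite_Diff finite_Int)
    then show ?thesis by (simp add: power_add)
  qed
  have sub: "?h ` stable_on (insert l L) \<subseteq> T \<times> stable_on L"
  proof safe
    fix I assume I: "I \<in> stable_on (insert l L)"
    have "B = C" if "B \<in> I \<inter> K" "C \<in> I \<inter> K" for B C
      using that I by (auto simp: K_def stable_on_def stable_def pairwise_def disjnt_iff)
    then show "I \<inter> K \<in> T" unfolding T_def by blast
    show "I - K \<in> stable_on L"
      using I by (auto simp: K_def stable_on_def stable_def pairwise_def disjnt_iff)
  qed
  have "(\<Sum>I\<in>stable_on (insert l L). ?a ^ card I) =
      (\<Sum>I\<in>stable_on (insert l L). ?a ^ card (fst (?h I)) * ?a ^ card (snd (?h I)))"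
    by (intro sum.cong refl) (simp only: card fst_conv snd_conv)
  also have "\<dots> = (\<Sum>(I, J)\<in>?h ` stable_on (insert l L). ?a ^ card I * ?a ^ card J)"
    by (subst sum.reindex[OF inj]) simp
  also have "\<dots> \<le> (\<Sum>(I, J)\<in>T \<times> stable_on L. ?a ^ card I * ?a ^ card J)"
    using sub finK a finite_stable_on
    by (intro sum_mono2) (auto simp: T_def)
  also have "\<dots> = (\<Sum>I\<in>T. ?a ^ card I) * (\<Sum>J\<in>stable_on L. ?a ^ card J)"
    by (simp add: sum.cartesian_product sum_product)
  also have "(\<Sum>I\<in>T. ?a ^ card I) = 1 + ?a * card K"
    unfolding T_def using finK
    by (subst sum.insert) (auto simp: sum.reindex)
  also have "(1 + ?a * card K) * (\<Sum>J\<in>stable_on L. ?a ^ card J) \<le> (4 / 3) * (4 / 3) ^ card L"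
    using line_weight[of l] insert.IH a
    by (intro mult_mono) (auto simp: K_def intro!: sum_nonneg)
  also have "\<dots> = (4 / 3) ^ card (insert l L)" using insert.hyps by simp
  finally show ?case .
qed

lemma finite_layered: "finite {r. layered J r \<and> length r \<le> k}"
proof (rule finite_subset)
  have "set r \<subseteq> Pow E" if "layered J r" for r
    using that by (induction r arbitrary: J) (auto simp: stable_def)
  then show "{r. layered J r \<and> length r \<le> k} \<subseteq> {r. set r \<subseteq> Pow E \<and> length r \<le> k}"
    by blast
qed (use finite_E in \<open>simp add: finite_lists_length_le\<close>)

text \<open>The value \<open>256 / 81\<close> reproduces itself: by induction the continuations of a
  first layer \<open>I\<close> weigh at most \<open>(256 / 81) ^ card I\<close>, and the sum over
  \<open>I\<close> then gives a factor \<open>4 / 3\<close> for each of the at most four lines of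
  each event in \<open>J\<close>. Bounding the length by \<open>k\<close> keeps the sums
  finite.\<close>

lemma sum_layered:
  assumes "J \<subseteq> E"
  shows "(\<Sum>r\<in>{r. layered J r \<and> length r \<le> k}. p ^ total r) \<le> (256 / 81) ^ card J"
  using assms
proof (induction k arbitrary: J)
  case 0
  have eq: "{r. layered J r \<and> length r \<le> 0} = {[]}" for J by auto
  show ?case unfolding eq by simp
next
  case (Suc k)
  let ?R = "\<lambda>J. {r. layered J r \<and> length r \<le> k}"
  define L where "L = \<Union> (lines ` J)"
  define N where "N = {I. I \<noteq> {} \<and> stable I \<and> (\<forall>B\<in>I. meets J B)}"
  have finJ: "finite J" using Suc.prems finite_E finite_subset by blast
  have finL: "finite L" using finJ finite_lines Suc.prems by (auto simp: L_def)
  have "card L \<le> (\<Sum>B\<in>J. card (lines B))" unfolding L_def by (rule card_UN_le[OF finJ])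
  also have "\<dots> \<le> (\<Sum>B\<in>J. 4)" using card_lines Suc.prems by (intro sum_mono) auto
  finally have card_L: "card L \<le> 4 * card J" by simp
  \<comment> \<open>Hence \<open>stable_on L\<close> consists of the possible first layers after
    \<open>J\<close> and of the empty set, whose weight 1 stands for the empty sequence.\<close>
  have "\<not> disjnt (lines B) L \<longleftrightarrow> meets J B" for B
    by (auto simp: L_def meets_def disjnt_iff)
  then have stable_on: "stable_on L = insert {} N"
    by (auto simp: stable_on_def N_def stable_def)
  have finN: "finite N" using finite_stable_on[of L] stable_on by simp
  have eq: "{r. layered J r \<and> length r \<le> Suc k} = insert [] (\<Union>I\<in>N. (#) I ` ?R I)"
  proof (intro set_eqI)
    fix r show "r \<in> {r. layered J r \<and> length r \<le> Suc k} \<longleftrightarrow> r \<in> insert [] (\<Union>I\<in>N. (#) I ` ?R I)"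
      by (cases r) (auto simp: N_def)
  qed
  note fin = finite_layered[of _ k]
  have "(\<Sum>r\<in>{r. layered J r \<and> length r \<le> Suc k}. p ^ total r) =
      1 + (\<Sum>r\<in>(\<Union>I\<in>N. (#) I ` ?R I). p ^ total r)"
    unfolding eq using finN fin by (subst sum.insert) auto
  also have "(\<Sum>r\<in>(\<Union>I\<in>N. (#) I ` ?R I). p ^ total r) = (\<Sum>I\<in>N. \<Sum>r\<in>(#) I ` ?R I. p ^ total r)"
    using finN fin by (intro sum.UNION_disjoint) auto
  also have "\<dots> = (\<Sum>I\<in>N. p ^ card I * (\<Sum>r\<in>?R I. p ^ total r))"
    by (intro sum.cong refl) (simp add: sum.reindex power_add sum_distrib_left)
  also have "\<dots> \<le> (\<Sum>I\<in>N. p ^ card I * (256 / 81) ^ card I)"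
    using p_nonneg by (intro sum_mono mult_left_mono Suc.IH) (auto simp: N_def stable_def)
  also have "1 + \<dots> = (\<Sum>I\<in>stable_on L. (256 / 81 * p) ^ card I)"
    unfolding stable_on using finN
    by (subst sum.insert) (auto simp: N_def power_mult_distrib[symmetric] mult_ac)
  also have "\<dots> \<le> (4 / 3) ^ card L" by (rule sum_stable_on[OF finL])
  also have "\<dots> \<le> (4 / 3) ^ (4 * card J)" using card_L by (intro power_increasing) auto
  also have "\<dots> = (256 / 81) ^ card J" by (simp add: power_mult power_divide)
  finally show ?case by simp
qed

text \<open>Under the sum over \<open>S\<close> every letter of a trace costs a factor
  \<open>p\<close>, the final letter \<open>B\<close> included; the remaining count is
  \<open>sum_layered\<close> with \<open>J = {B}\<close>.\<close>

lemma potential_sum: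
  assumes B: "B \<in> E"
  shows "(\<Sum>s\<in>S. potential B s) \<le> ennreal (256 / 81 * p) * of_nat (card S)"
proof -
  let ?V = "{r. layered {B} r}"
  let ?w = "\<lambda>r. ennreal (p ^ total r)"
  have bound: "(\<integral>\<^sup>+ r. ?w r \<partial>count_space ?V) \<le> ennreal (256 / 81)"
  proof -
    \<comment> \<open>Truncation by length and monotone convergence pass from the finite sums of
      \<open>sum_layered\<close> to the infinite one.\<close>
    let ?f = "\<lambda>k r. ?w r * indicator {r. length r \<le> k} r"
    have "(\<integral>\<^sup>+ r. ?w r \<partial>count_space ?V) = (\<integral>\<^sup>+ r. (SUP k. ?f k r) \<partial>count_space ?V)"
    proof (intro nn_integral_cong)
      fix r :: "'b set list"
      show "?w r = (SUP k. ?f k r)"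
        by (rule antisym, rule SUP_upper2[of "length r"]) 
          (auto intro!: SUP_least split: split_indicator)
    qed
    also have "\<dots> = (SUP k. \<integral>\<^sup>+ r. ?f k r \<partial>count_space ?V)"
      by (intro nn_integral_monotone_convergence_SUP incseq_SucI)
        (auto simp: le_fun_def split: split_indicator)
    also have "\<dots> \<le> ennreal (256 / 81)"
    proof (rule SUP_least)
      fix k
      let ?R = "{r. layered {B} r \<and> length r \<le> k}"
      have "(\<integral>\<^sup>+ r. ?f k r \<partial>count_space ?V) = (\<Sum>r\<in>?R. ?f k r)"
        using finite_layered by (intro nn_integral_count_space') auto
      also have "\<dots> = ennreal (\<Sum>r\<in>?R. p ^ total r)"
        using p_nonneg by (subst sum_ennreal[symmetric]) (auto intro!: sum.cong)
      also have "\<dots> \<le> ennreal (256 / 81)"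
        using sum_layered[of "{B}" k] B by (intro ennreal_leI) simp
      finally show "(\<integral>\<^sup>+ r. ?f k r \<partial>count_space ?V) \<le> ennreal (256 / 81)" .
    qed
    finally show ?thesis .
  qed
  have "(\<Sum>s\<in>S. potential B s) =
      (\<integral>\<^sup>+ r. (\<Sum>s\<in>S. A_layers r (A B (\<lambda>_. 1)) s) \<partial>count_space ?V)"
    unfolding potential_def by (subst nn_integral_sum) auto
  also have "\<dots> = (\<integral>\<^sup>+ r. ?w r * (ennreal p * of_nat (card S)) \<partial>count_space ?V)"
    by (intro nn_integral_cong) (simp add: A_layers_sum A_sum B)
  also have "\<dots> = (\<integral>\<^sup>+ r. ?w r \<partial>count_space ?V) * (ennreal p * of_nat (card S))"
    by (rule nn_integral_multc) simp
  also have "\<dots> \<le> ennreal (256 / 81) * (ennreal p * of_nat (card S))"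
    by (intro mult_right_mono bound) simp
  also have "\<dots> = ennreal (256 / 81 * p) * of_nat (card S)"
    using p_nonneg by (simp only: ennreal_mult' mult.assoc)
  finally show ?thesis .
qed

end

section \<open>Resampling operators on permutations\<close>

definition cell_lines :: "cell \<Rightarrow> (nat + nat) set" where
  "cell_lines c = {Inl (fst c), Inr (snd c)}"

definition event_lines :: "event \<Rightarrow> (nat + nat) set" where
  "event_lines B = cell_lines (fst B) \<union> cell_lines (snd B)"

text \<open>Resampling of one selected cell without its normalising factor \<open>1 / n\<close>,
  which avoids division in \<open>ennreal\<close>.\<close>

definition cell_op :: "nat \<Rightarrow> cell \<Rightarrow> ((nat \<Rightarrow> nat) \<Rightarrow> ennreal) \<Rightarrow> (nat \<Rightarrow> nat) \<Rightarrow> ennreal" where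
  "cell_op n c f \<pi> =
     (if \<pi> (fst c) = snd c then \<Sum>a\<in>{1..n}. f (swap_values \<pi> (fst c) a) else 0)"

text \<open>Although both sums run over \<open>{1..n}\<close>, only \<open>n * (n - 1)\<close> pairs
  count for a bad-event: a first swap with the row of the second cell makes that cell false, and the
  inner operator then gives 0.\<close>

definition event_op :: "nat \<Rightarrow> event \<Rightarrow> ((nat \<Rightarrow> nat) \<Rightarrow> ennreal) \<Rightarrow> (nat \<Rightarrow> nat) \<Rightarrow> ennreal" where
  "event_op n B f = cell_op n (fst B) (cell_op n (snd B) f)"

definition cell_ind :: "cell \<Rightarrow> (nat \<Rightarrow> nat) \<Rightarrow> ennreal" where
  "cell_ind c \<pi> = (if \<pi> (fst c) = snd c then 1 else 0)"

lemma disjnt_cell_lines: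
  "disjnt (cell_lines c) (cell_lines d) \<longleftrightarrow> fst c \<noteq> fst d \<and> snd c \<noteq> snd d"
  by (auto simp: cell_lines_def disjnt_def)

lemma disjnt_event_lines:
  "disjnt (event_lines B) (event_lines C) \<longleftrightarrow>
     disjnt (cell_lines (fst B)) (cell_lines (fst C)) \<and>
     disjnt (cell_lines (fst B)) (cell_lines (snd C)) \<and>
     disjnt (cell_lines (snd B)) (cell_lines (fst C)) \<and>
     disjnt (cell_lines (snd B)) (cell_lines (snd C))"
  by (auto simp: event_lines_def disjnt_Un1 disjnt_Un2)

section \<open>Commutation of single-cell resamplings and agreement with the algorithm's
  draws\<close>

lemma permutes_swap_values:
  assumes "\<pi> permutes {1..n}" "x \<in> {1..n}" "a \<in> {1..n}"
  shows "swap_values \<pi> x a permutes {1..n}"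
proof -
  have "Transposition.transpose x a permutes {1..n}"
    unfolding permutes_def using assms(2,3)
    by (metis transpose_apply_other transpose_involutory)
  then show ?thesis
    unfolding swap_values_def using assms(1) by (rule permutes_compose)
qed

text \<open>Disjoint transpositions commute. Where the two share a position, conjugating one by the
  other rewrites the product in the opposite order with new partners, and the witnesses record these
  partners.\<close>

lemma sum_swap_pairs_commute:
  fixes g :: "(nat \<Rightarrow> nat) \<Rightarrow> ennreal"
  assumes "x \<in> X" "x' \<in> X" "x \<noteq> x'"
  shows "(\<Sum>a\<in>X - {x'}. \<Sum>b\<in>X. g (Transposition.transpose x a \<circ> Transposition.transpose x' b)) =
         (\<Sum>b\<in>X - {x}. \<Sum>a\<in>X. g (Transposition.transpose x' b \<circ> Transposition.transpose x a))"
  unfolding sum.cartesian_product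
proof (rule sum.reindex_bij_witness[where
        i = "\<lambda>(b, a). if b = a then (if b = x' then (x, x) else (b, x))
               else if a = x' then (b, b) else (a, b)" and
        j = "\<lambda>(a, b). if a = b then (if a = x then (x', x') else (a, x'))
               else if b = x then (a, a) else (b, a)"], goal_cases)
  case (5 p)
  then obtain a b where p: "p = (a, b)" "a \<noteq> x'" by auto
  consider "a = b" "a = x" | "a = b" "a \<noteq> x" | "a \<noteq> b" "b = x" | "a \<noteq> b" "b \<noteq> x" by blast
  then show ?case
    by cases (use p assms in \<open>simp_all add: fun_eq_iff Transposition.transpose_def
      arg_cong[of _ _ g]\<close>)
qed (use assms in \<open>auto split: if_splits\<close>)

text \<open>The algorithm bars \<open>x\<close> from the second draw, whereas products of operators
  bar \<open>x'\<close> from the first. The pairs with \<open>a = x'\<close> are rewritten by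
  conjugation as those with \<open>b = x\<close>; all others stay fixed.\<close>

lemma sum_swap_pairs_restrict:
  fixes g :: "(nat \<Rightarrow> nat) \<Rightarrow> ennreal"
  assumes "x \<in> X" "x' \<in> X" "x \<noteq> x'"
  shows "(\<Sum>a\<in>X. \<Sum>b\<in>X - {x}. g (Transposition.transpose x a \<circ> Transposition.transpose x' b)) =
         (\<Sum>a\<in>X - {x'}. \<Sum>b\<in>X. g (Transposition.transpose x a \<circ> Transposition.transpose x' b))"
  unfolding sum.cartesian_product
proof (rule sum.reindex_bij_witness[where
        i = "\<lambda>(a, b). if b = x then (x', if a = x then x' else a) else (a, b)" and
        j = "\<lambda>(a, b). if a = x' then (if b = x' then x else b, x) else (a, b)"], goal_cases)
  case (5 p)
  then obtain a b where p: "p = (a, b)" "b \<noteq> x" by auto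
  consider "a = x'" "b = x'" | "a = x'" "b \<noteq> x'" | "a \<noteq> x'" by blast
  then show ?case
    by cases (use p assms in \<open>simp_all add: fun_eq_iff Transposition.transpose_def
      arg_cong[of _ _ g]\<close>)
qed (use assms in \<open>auto split: if_splits\<close>)

text \<open>
  Swapping \<open>x\<close> with the position of another cell of the selection puts the value at \<open>x\<close> there,
  so that cell survives only if the swap avoids it.
\<close>

lemma cell_op_cond:
  assumes "fst c \<noteq> fst d" "snd c \<noteq> snd d" "\<And>\<pi>. \<pi> (fst d) \<noteq> snd d \<Longrightarrow> h \<pi> = 0"
  shows "cell_op n c h \<pi> =
    (if \<pi> (fst c) = snd c \<and> \<pi> (fst d) = snd d
     then \<Sum>a\<in>{1..n} - {fst d}. h (swap_values \<pi> (fst c) a) else 0)"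
proof -
  have *: "swap_values \<pi> (fst c) a (fst d) = (if a = fst d then \<pi> (fst c) else \<pi> (fst d))" for a
    using assms(1) by (auto simp: swap_values_def Transposition.transpose_def)
  have "h (swap_values \<pi> (fst c) a) = 0"
    if "\<pi> (fst c) = snd c" "a = fst d \<or> \<pi> (fst d) \<noteq> snd d" for a
    using that assms(2) by (intro assms(3)) (auto simp: *)
  then show ?thesis
    by (auto simp: cell_op_def intro!: sum.mono_neutral_right sum.neutral)
qed

lemma cell_op_cell_op:
  assumes "fst c \<noteq> fst d" "snd c \<noteq> snd d"
  shows "cell_op n c (cell_op n d f) \<pi> =
    (if \<pi> (fst c) = snd c \<and> \<pi> (fst d) = snd d
     then \<Sum>a\<in>{1..n} - {fst d}. \<Sum>b\<in>{1..n}.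
       f (\<pi> \<circ> (Transposition.transpose (fst c) a \<circ> Transposition.transpose (fst d) b)) else 0)"
proof -
  have *: "swap_values \<pi> (fst c) a (fst d) = \<pi> (fst d)" if "a \<noteq> fst d" for a
    using assms(1) that by (auto simp: swap_values_def Transposition.transpose_def)
  show ?thesis
    using * by (subst cell_op_cond[of c d])
      (auto simp: assms cell_op_def swap_values_def comp_assoc intro!: sum.cong)
qed

lemma cell_op_commute:
  assumes "fst c \<noteq> fst d" "snd c \<noteq> snd d" "fst c \<in> {1..n}" "fst d \<in> {1..n}"
  shows "cell_op n c (cell_op n d f) = cell_op n d (cell_op n c f)"
proof
  fix \<pi>
  show "cell_op n c (cell_op n d f) \<pi> = cell_op n d (cell_op n c f) \<pi>"
    using assms sum_swap_pairs_commute[of "fst c" "{1..n}" "fst d" "\<lambda>\<sigma>. f (\<pi> \<circ> \<sigma>)"]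
    by (simp add: cell_op_cell_op conj_commute)
qed

lemma cell_op_mono: "f \<le> g \<Longrightarrow> cell_op n c f \<le> cell_op n c g"
  by (auto simp: cell_op_def le_fun_def intro!: sum_mono)

lemma cell_op_cmult: "cell_op n c (\<lambda>\<pi>. k * f \<pi>) = (\<lambda>\<pi>. k * cell_op n c f \<pi>)"
  by (simp add: cell_op_def fun_eq_iff sum_distrib_left)

lemma cell_op_nn_integral:
  "cell_op n c (\<lambda>\<pi>. \<integral>\<^sup>+ r. F r \<pi> \<partial>count_space X) =
     (\<lambda>\<pi>. \<integral>\<^sup>+ r. cell_op n c (F r) \<pi> \<partial>count_space X)"
  by (simp add: cell_op_def fun_eq_iff nn_integral_sum)

lemma event_op_mono: "f \<le> g \<Longrightarrow> event_op n B f \<le> event_op n B g"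
  unfolding event_op_def by (intro cell_op_mono)

lemma event_op_cmult: "event_op n B (\<lambda>\<pi>. k * f \<pi>) = (\<lambda>\<pi>. k * event_op n B f \<pi>)"
  by (simp add: event_op_def cell_op_cmult)

lemma event_op_add: "event_op n B (\<lambda>\<pi>. f \<pi> + g \<pi>) = (\<lambda>\<pi>. event_op n B f \<pi> + event_op n B g \<pi>)"
proof -
  have "cell_op n c (\<lambda>\<pi>. f \<pi> + g \<pi>) = (\<lambda>\<pi>. cell_op n c f \<pi> + cell_op n c g \<pi>)" for c f g
    by (simp add: cell_op_def fun_eq_iff sum.distrib)
  then show ?thesis by (simp add: event_op_def)
qed

lemma event_op_sum: "event_op n B (\<lambda>\<pi>. \<Sum>i\<in>I. F i \<pi>) = (\<lambda>\<pi>. \<Sum>i\<in>I. event_op n B (F i) \<pi>)"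
proof -
  have "cell_op n c (\<lambda>\<pi>. \<Sum>i\<in>I. F i \<pi>) = (\<lambda>\<pi>. \<Sum>i\<in>I. cell_op n c (F i) \<pi>)" for c F
  proof
    fix \<pi>
    show "cell_op n c (\<lambda>\<pi>. \<Sum>i\<in>I. F i \<pi>) \<pi> = (\<Sum>i\<in>I. cell_op n c (F i) \<pi>)"
      by (cases "\<pi> (fst c) = snd c") (simp_all add: cell_op_def, rule sum.swap)
  qed
  then show ?thesis by (simp add: event_op_def)
qed

lemma event_op_nn_integral:
  "event_op n B (\<lambda>\<pi>. \<integral>\<^sup>+ r. F r \<pi> \<partial>count_space X) =
     (\<lambda>\<pi>. \<integral>\<^sup>+ r. event_op n B (F r) \<pi> \<partial>count_space X)"
  by (simp add: event_op_def cell_op_nn_integral)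

lemma bad_eventsD:
  assumes "B \<in> bad_events n M"
  shows "fst B \<in> {1..n} \<times> {1..n}" "snd B \<in> {1..n} \<times> {1..n}"
    "fst (fst B) \<noteq> fst (snd B)" "snd (fst B) \<noteq> snd (snd B)"
  using assms by (auto simp: bad_events_def)

lemma event_op_commute:
  assumes "B \<in> bad_events n M" "C \<in> bad_events n M" "disjnt (event_lines B) (event_lines C)"
  shows "event_op n B (event_op n C f) = event_op n C (event_op n B f)"
proof -
  have "cell_op n c (cell_op n d g) = cell_op n d (cell_op n c g)"
    if "c \<in> {fst B, snd B}" "d \<in> {fst C, snd C}" for c d g
  proof (rule cell_op_commute)
    show "fst c \<noteq> fst d" "snd c \<noteq> snd d"
      using that assms(3) by (auto simp: disjnt_event_lines disjnt_cell_lines)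
    show "fst c \<in> {1..n}"
      using that(1) bad_eventsD(1,2)[OF assms(1)] by (metis insert_iff singletonD mem_Times_iff)
    show "fst d \<in> {1..n}"
      using that(2) bad_eventsD(1,2)[OF assms(2)] by (metis insert_iff singletonD mem_Times_iff)
  qed
  note * = this[of "fst B" "fst C"] this[of "fst B" "snd C"]
    this[of "snd B" "fst C"] this[of "snd B" "snd C"]
  show ?thesis unfolding event_op_def by (simp add: *)
qed

text \<open>Serves both to identify the two ordered versions of a bad-event and to choose freely
  which of its cells is resampled last.\<close>

lemma event_op_swap:
  assumes "B \<in> bad_events n M"
  shows "event_op n (prod.swap B) f = event_op n B f"
proof -
  have "fst (snd B) \<in> {1..n}" "fst (fst B) \<in> {1..n}"
    using bad_eventsD(1,2)[OF assms] by auto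
  then show ?thesis
    using bad_eventsD(3,4)[OF assms]
    by (simp only: event_op_def fst_swap snd_swap cell_op_commute[of "snd B" "fst B"] not_sym)
qed

text \<open>Here the operator takes the form of the two draws in \<open>resample\<close>, up to
  normalisation.\<close>

lemma event_op_eq:
  assumes "B \<in> bad_events n M" "holds_on \<pi> B"
  shows "event_op n B f \<pi> = (\<Sum>a\<in>{1..n}. \<Sum>b\<in>{1..n} - {fst (fst B)}.
    f (swap_values (swap_values \<pi> (fst (fst B)) a) (fst (snd B)) b))"
proof -
  obtain x y x' y' where eq: "B = ((x, y), (x', y'))" by (metis surj_pair)
  have "x \<noteq> x'" "y \<noteq> y'" "x \<in> {1..n}" "x' \<in> {1..n}" "\<pi> x = y" "\<pi> x' = y'"
    using bad_eventsD[OF assms(1)] assms(2) by (auto simp: eq holds_on_def)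
  then show ?thesis
    using sum_swap_pairs_restrict[of x "{1..n}" x' "\<lambda>\<sigma>. f (\<pi> \<circ> \<sigma>)"]
    by (simp add: eq event_op_def cell_op_cell_op swap_values_def comp_assoc)
qed

lemma event_op_not_holds:
  assumes "B \<in> bad_events n M" "\<not> holds_on \<pi> B"
  shows "event_op n B f \<pi> = 0"
proof -
  obtain x y x' y' where eq: "B = ((x, y), (x', y'))" by (metis surj_pair)
  then show ?thesis
    using bad_eventsD(3,4)[OF assms(1)] assms(2)
    by (cases "\<pi> x = y") (simp_all add: event_op_def cell_op_cell_op holds_on_def)
qed

lemma event_op_one:
  assumes "B \<in> bad_events n M"
  shows "event_op n B (\<lambda>_. 1) \<pi> = (if holds_on \<pi> B then of_nat (n * (n - 1)) else 0)"
proof (cases "holds_on \<pi> B")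
  case True
  have "fst (fst B) \<in> {1..n}" using bad_eventsD(1)[OF assms] by auto
  then show ?thesis using True by (simp add: event_op_eq[OF assms] card_Diff_singleton)
qed (simp add: event_op_not_holds[OF assms])

section \<open>Invariance of the uniform measure, and the effect of a resampling on one cell\<close>

lemma sum_permutes_preimage:
  fixes v :: ennreal and n :: nat
  assumes "\<pi> permutes {1..n}" "y \<in> {1..n}"
  shows "(\<Sum>a\<in>{1..n}. if \<pi> a = y then v else 0) = v"
proof -
  have "\<pi> a = y \<longleftrightarrow> a = inv \<pi> y" for a
    using permutes_inverses[OF assms(1)] by metis
  moreover have "inv \<pi> y \<in> {1..n}"
    using assms permutes_in_image[OF permutes_inv[OF assms(1)]] by simp
  ultimately show ?thesis
    by (simp only: sum.delta finite_atLeastAtMost if_True)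
qed

lemma sum_permutes_swap_values:
  fixes f :: "(nat \<Rightarrow> nat) \<Rightarrow> ennreal"
  assumes "x \<in> {1..n}" "a \<in> {1..n}"
  shows "(\<Sum>\<pi> | \<pi> permutes {1..n}. f (swap_values \<pi> x a)) = (\<Sum>\<pi> | \<pi> permutes {1..n}. f \<pi>)"
  by (rule sum.reindex_bij_witness[where i = "\<lambda>\<pi>. swap_values \<pi> x a" and j = "\<lambda>\<pi>. swap_values \<pi> x a"])
    (use assms permutes_swap_values in \<open>auto simp: swap_values_def comp_assoc\<close>)

text \<open>The swap maps the pairs \<open>(\<pi>, a)\<close> with \<open>\<pi> x = y\<close>
  bijectively to those with \<open>\<pi> a = y\<close>, and each permutation has exactly one such
  \<open>a\<close>.\<close>

lemma cell_op_sum_permutes: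
  assumes "c \<in> {1..n} \<times> {1..n}"
  shows "(\<Sum>\<pi> | \<pi> permutes {1..n}. cell_op n c f \<pi>) = (\<Sum>\<pi> | \<pi> permutes {1..n}. f \<pi>)"
proof -
  obtain x y where c: "c = (x, y)" "x \<in> {1..n}" "y \<in> {1..n}" using assms by auto
  let ?P = "{\<pi>. \<pi> permutes {1..n}}"
  have "(\<Sum>\<pi>\<in>?P. cell_op n c f \<pi>) =
      (\<Sum>\<pi>\<in>?P. \<Sum>a\<in>{1..n}. if swap_values \<pi> x a a = y then f (swap_values \<pi> x a) else 0)"
    by (auto simp: c cell_op_def swap_values_def intro!: sum.cong)
  also have "\<dots> = (\<Sum>a\<in>{1..n}. \<Sum>\<pi>\<in>?P. if swap_values \<pi> x a a = y then f (swap_values \<pi> x a) else 0)"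
    by (rule sum.swap)
  also have "\<dots> = (\<Sum>a\<in>{1..n}. \<Sum>\<pi>\<in>?P. if \<pi> a = y then f \<pi> else 0)"
  proof (rule sum.cong[OF refl])
    fix a assume "a \<in> {1..n}"
    then show "(\<Sum>\<pi>\<in>?P. if swap_values \<pi> x a a = y then f (swap_values \<pi> x a) else 0) =
        (\<Sum>\<pi>\<in>?P. if \<pi> a = y then f \<pi> else 0)"
      by (rule sum_permutes_swap_values[OF c(2), where f = "\<lambda>\<pi>. if \<pi> a = y then f \<pi> else 0"])
  qed
  also have "\<dots> = (\<Sum>\<pi>\<in>?P. \<Sum>a\<in>{1..n}. if \<pi> a = y then f \<pi> else 0)"
    by (rule sum.swap)
  also have "\<dots> = (\<Sum>\<pi>\<in>?P. f \<pi>)"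
    using c by (intro sum.cong refl sum_permutes_preimage) auto
  finally show ?thesis .
qed

lemma event_op_sum_permutes:
  assumes "B \<in> bad_events n M"
  shows "(\<Sum>\<pi> | \<pi> permutes {1..n}. event_op n B f \<pi>) = (\<Sum>\<pi> | \<pi> permutes {1..n}. f \<pi>)"
  unfolding event_op_def
  by (simp only: cell_op_sum_permutes[OF bad_eventsD(1)[OF assms]]
      cell_op_sum_permutes[OF bad_eventsD(2)[OF assms]])

text \<open>At most one draw makes \<open>e\<close> true. In a shared row the drawn position must
  hold the value of \<open>e\<close>; in a shared column the value of \<open>c\<close> must be sent
  to the row of \<open>e\<close>.\<close>

lemma cell_op_cell_ind:
  assumes "\<pi> permutes {1..n}" "e \<in> {1..n} \<times> {1..n}"
    and "\<not> disjnt (cell_lines c) (cell_lines e)"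
  shows "cell_op n c (cell_ind e) \<pi> \<le> cell_ind c \<pi>"
proof (cases "\<pi> (fst c) = snd c")
  case True
  have "cell_op n c (cell_ind e) \<pi> \<le> 1"
  proof (cases "fst c = fst e")
    case True
    then have "cell_op n c (cell_ind e) \<pi> \<le> (\<Sum>a\<in>{1..n}. if \<pi> a = snd e then 1 else 0)"
      by (auto simp: cell_op_def cell_ind_def swap_values_def)
    also have "\<dots> = 1" using assms by (intro sum_permutes_preimage) auto
    finally show ?thesis .
  next
    case False
    then have "snd c = snd e" using assms(3) by (auto simp: disjnt_cell_lines)
    moreover have "\<pi> (fst e) \<noteq> \<pi> (fst c)"
      using False inj_eq[OF permutes_inj[OF assms(1)]] by simp
    ultimately have "cell_ind e (swap_values \<pi> (fst c) a) = (if a = fst e then 1 else 0)" for a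
      using True False by (simp add: cell_ind_def swap_values_def Transposition.transpose_def)
    then have "cell_op n c (cell_ind e) \<pi> = (\<Sum>a\<in>{1..n}. if a = fst e then 1 else 0)"
      using True by (simp add: cell_op_def)
    then show ?thesis by simp
  qed
  then show ?thesis using True by (simp add: cell_ind_def)
qed (simp add: cell_op_def)

text \<open>Let the cell that shares a line with \<open>e\<close> be resampled last. The first swap
  has \<open>n - 1\<close> admissible positions, and after each of them at most one second draw
  makes \<open>e\<close> true.\<close>

lemma event_op_cell_ind_dependent:
  assumes B: "B \<in> bad_events n M" and \<pi>: "\<pi> permutes {1..n}" and e: "e \<in> {1..n} \<times> {1..n}"
    and dep: "\<not> disjnt (event_lines B) (cell_lines e)"
  shows "event_op n B (cell_ind e) \<pi> \<le> of_nat (n - 1)"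
proof -
  have *: "cell_op n c (cell_op n d (cell_ind e)) \<pi> \<le> of_nat (n - 1)"
    if cd: "(c, d) \<in> {B, prod.swap B}" "\<not> disjnt (cell_lines d) (cell_lines e)" for c d
  proof -
    have c: "fst c \<noteq> fst d" "snd c \<noteq> snd d" "fst c \<in> {1..n}" "fst d \<in> {1..n}"
      using cd(1) bad_eventsD[OF B] by (cases B; auto)+
    have "cell_op n c (cell_op n d (cell_ind e)) \<pi> \<le>
        (\<Sum>a\<in>{1..n} - {fst d}. cell_op n d (cell_ind e) (swap_values \<pi> (fst c) a))"
      using c by (subst cell_op_cond[of c d]) (auto simp: cell_op_def)
    also have "\<dots> \<le> (\<Sum>a\<in>{1..n} - {fst d}. 1)"
    proof (intro sum_mono)
      fix a assume "a \<in> {1..n} - {fst d}"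
      then have "swap_values \<pi> (fst c) a permutes {1..n}"
        using \<pi> c by (intro permutes_swap_values) auto
      from cell_op_cell_ind[OF this e cd(2)]
      show "cell_op n d (cell_ind e) (swap_values \<pi> (fst c) a) \<le> 1"
        by (rule order_trans) (simp add: cell_ind_def)
    qed
    also have "\<dots> = of_nat (n - 1)" using c by (simp add: card_Diff_singleton)
    finally show ?thesis .
  qed
  consider "\<not> disjnt (cell_lines (snd B)) (cell_lines e)"
    | "\<not> disjnt (cell_lines (fst B)) (cell_lines e)"
    using dep by (auto simp: event_lines_def disjnt_Un1)
  then show ?thesis
  proof cases
    case 1
    then show ?thesis using *[of "fst B" "snd B"] by (simp add: event_op_def)
  next
    case 2
    then show ?thesis
      using *[of "snd B" "fst B"] event_op_swap[OF B, of "cell_ind e"]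
      by (cases B) (simp add: event_op_def)
  qed
qed

text \<open>The row of \<open>e\<close> keeps its value or receives one of the two values of
  \<open>B\<close>, and these differ from the column of \<open>e\<close>. So \<open>e\<close> cannot
  become true.\<close>

lemma event_op_cell_ind_independent:
  assumes B: "B \<in> bad_events n M" and disj: "disjnt (event_lines B) (cell_lines e)"
  shows "event_op n B (cell_ind e) \<pi> \<le> of_nat (n * (n - 1)) * cell_ind e \<pi>"
proof (cases "\<pi> (fst e) = snd e")
  case True
  have "event_op n B (cell_ind e) \<pi> \<le> event_op n B (\<lambda>_. 1) \<pi>"
    using event_op_mono[of "cell_ind e" "\<lambda>_. 1"] by (auto simp: le_fun_def cell_ind_def)
  also have "\<dots> \<le> of_nat (n * (n - 1))" by (simp add: event_op_one[OF B])
  finally show ?thesis using True by (simp add: cell_ind_def)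
next
  case False
  obtain x y x' y' u v where eq: "B = ((x, y), (x', y'))" "e = (u, v)"
    by (metis surj_pair)
  have ne: "x \<noteq> u" "x' \<noteq> u" "y \<noteq> v" "y' \<noteq> v" and x: "x \<noteq> x'" "y \<noteq> y'"
    using disj bad_eventsD(3,4)[OF B] by (auto simp: eq event_lines_def disjnt_Un1 disjnt_cell_lines)
  have "cell_ind e (\<pi> \<circ> (Transposition.transpose x a \<circ> Transposition.transpose x' b)) = 0"
    if "\<pi> x = y" "\<pi> x' = y'" "a \<noteq> x'" for a b
    using that ne x False by (simp add: eq cell_ind_def Transposition.transpose_def)
  then have "event_op n B (cell_ind e) \<pi> = 0"
    using x by (simp add: event_op_def eq cell_op_cell_op)
  then show ?thesis by simp
qed

section \<open>Potentials for the Swapping Algorithm\<close>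

lemma nn_integral_bind_spmf:
  "(\<integral>\<^sup>+ y. f y \<partial>measure_spmf (bind_spmf p g)) =
     (\<integral>\<^sup>+ x. \<integral>\<^sup>+ y. f y \<partial>measure_spmf (g x) \<partial>measure_spmf p)"
  unfolding measure_spmf_bind
  by (subst nn_integral_bind[where B = "count_space UNIV"])
    (auto simp: comp_def space_subprob_algebra intro!: measure_spmf.subprob_space_axioms)

lemma nn_integral_return_spmf: "(\<integral>\<^sup>+ y. f y \<partial>measure_spmf (return_spmf x)) = f x"
  by (simp add: measure_spmf_return_spmf nn_integral_return)

lemma pmf_bind_spmf_None_lossless:
  assumes "lossless_spmf p"
  shows "ennreal (pmf (bind_spmf p f) None) = (\<integral>\<^sup>+ x. ennreal (pmf (f x) None) \<partial>measure_spmf p)"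
proof -
  have "integrable (measure_spmf p) (\<lambda>x. pmf (f x) None)"
    by (rule measure_spmf.integrable_const_bound[where B = 1]) (auto simp: pmf_le_1)
  then show ?thesis
    using assms by (simp add: pmf_bind_spmf_None lossless_iff_pmf_None nn_integral_eq_integral)
qed

text \<open>The mass that the supremum of a chain gives to \<open>X\<close> is the supremum of the
  masses, so an upper bound survives the limit in a fixed point induction.\<close>

lemma admissible_emeasure_spmf_le:
  "spmf.admissible (\<lambda>f. emeasure (measure_spmf (f t)) X \<le> c)"
proof (rule ccpo.admissibleI)
  fix F assume chain: "Complete_Partial_Order.chain (fun_ord (ord_spmf (=))) F"
    and ne: "F \<noteq> {}" and le: "\<forall>f\<in>F. emeasure (measure_spmf (f t)) X \<le> c"
  let ?Y = "{y. \<exists>f\<in>F. y = f t}"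
  have "Complete_Partial_Order.chain (ord_spmf (=)) ?Y"
    using chain by (rule chain_fun)
  moreover have "?Y \<noteq> {}" using ne by auto
  ultimately have "emeasure (measure_spmf (lub_spmf ?Y)) X = (SUP y\<in>?Y. emeasure (measure_spmf y) X)"
    by (rule emeasure_lub_spmf)
  also have "\<dots> \<le> c" using le by (auto intro!: SUP_least)
  finally show "emeasure (measure_spmf (fun_lub lub_spmf F t)) X \<le> c"
    by (simp add: fun_lub_def)
qed

text \<open>
  Both ordered versions of a bad-event have the same resampling operator, so the version with the
  smaller row first can stand for the unordered event.
\<close>

definition canon :: "event \<Rightarrow> event" where
  "canon B = (if fst (fst B) < fst (snd B) then B else prod.swap B)"

lemma event_lines_canon [simp]: "event_lines (canon B) = event_lines B"
  by (auto simp: canon_def event_lines_def)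

lemma holds_on_canon [simp]: "holds_on \<pi> (canon B) \<longleftrightarrow> holds_on \<pi> B"
  by (auto simp: canon_def holds_on_def split: prod.splits)

lemma bad_events_swap: "B \<in> bad_events n M \<Longrightarrow> prod.swap B \<in> bad_events n M"
  by (auto simp: bad_events_def)

lemma canon_bad_events: "B \<in> bad_events n M \<Longrightarrow> canon B \<in> bad_events n M"
  by (simp add: canon_def bad_events_swap)

lemma event_op_canon: "B \<in> bad_events n M \<Longrightarrow> event_op n (canon B) f = event_op n B f"
  by (simp add: canon_def event_op_swap)

lemma latin_transversal_selection:
  assumes \<pi>: "\<pi> permutes {1..n}" and none: "true_bad_events n M \<pi> = {}"
  shows "latin_transversal n M (selection n \<pi>)"
proof -
  have range: "\<pi> x \<in> {1..n} \<longleftrightarrow> x \<in> {1..n}" for x by (rule permutes_in_image[OF \<pi>])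
  have inj: "\<pi> x = \<pi> x' \<longleftrightarrow> x = x'" for x x' by (rule inj_eq[OF permutes_inj[OF \<pi>]])
  have "inj_on (\<lambda>(x, y). M x y) (selection n \<pi>)"
  proof (rule inj_onI, rule ccontr)
    fix c d assume "c \<in> selection n \<pi>" "d \<in> selection n \<pi>"
      and col: "(case c of (x, y) \<Rightarrow> M x y) = (case d of (x, y) \<Rightarrow> M x y)" and "c \<noteq> d"
    then obtain x x' where "c = (x, \<pi> x)" "d = (x', \<pi> x')" "x \<in> {1..n}" "x' \<in> {1..n}" "x \<noteq> x'"
      by (auto simp: selection_def)
    then have "((x, \<pi> x), (x', \<pi> x')) \<in> true_bad_events n M \<pi>"
      using col range inj by (auto simp: true_bad_events_def bad_events_def holds_on_def)
    then show False using none by simp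
  qed
  moreover have "\<exists>!x. (x, y) \<in> selection n \<pi>" if "y \<in> {1..n}" for y
  proof (rule ex1I[of _ "inv \<pi> y"])
    show "(inv \<pi> y, y) \<in> selection n \<pi>"
      using that range[of "inv \<pi> y"] permutes_inverses(1)[OF \<pi>, of y] by (auto simp: selection_def)
    show "x = inv \<pi> y" if "(x, y) \<in> selection n \<pi>" for x
      using that permutes_inverses(2)[OF \<pi>] by (auto simp: selection_def)
  qed
  moreover have "selection n \<pi> \<subseteq> {1..n} \<times> {1..n}"
    by (auto simp: selection_def range simp del: atLeastAtMost_iff One_nat_def)
  moreover have "\<exists>!y. (x, y) \<in> selection n \<pi>" if "x \<in> {1..n}" for x
    using that by (simp add: selection_def)
  ultimately show ?thesis
    by (simp add: latin_transversal_def)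
qed

lemma sum_cell_ind:
  assumes "e \<in> {1..n} \<times> {1..n}"
  shows "of_nat n * (\<Sum>\<pi> | \<pi> permutes {1..n}. cell_ind e \<pi>) = of_nat (card {\<pi>. \<pi> permutes {1..n}})"
proof -
  have "cell_op n e (\<lambda>_. 1) \<pi> = of_nat n * cell_ind e \<pi>" for \<pi>
    by (simp add: cell_op_def cell_ind_def)
  then show ?thesis
    using cell_op_sum_permutes[OF assms, of "\<lambda>_. 1"] by (simp add: sum_distrib_left)
qed

lemma resample_permutes:
  assumes "B \<in> bad_events n M" "\<pi> permutes {1..n}" "\<pi>' \<in> set_spmf (resample n B \<pi>)"
  shows "\<pi>' permutes {1..n}"
proof -
  obtain x y x' y' where eq: "B = ((x, y), (x', y'))" by (metis surj_pair)
  have "x \<in> {1..n}" "x' \<in> {1..n}" using assms(1) by (auto simp: eq bad_events_def)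
  then show ?thesis using assms(2,3)
    by (auto simp: eq resample_def set_bind_spmf Let_def simp del: One_nat_def
        intro!: permutes_swap_values)
qed

section \<open>Color counts and the instance of the general potential\<close>

locale swapping =
  fixes n \<Delta> :: nat and M :: "nat \<Rightarrow> nat \<Rightarrow> 'c"
  assumes n_pos: "n \<ge> 1"
    and card_color: "\<And>c. card (color_class n M c) \<le> \<Delta>"
    and \<Delta>_le: "real \<Delta> \<le> 27 / 256 * real n"
begin

text \<open>The probability of one pair of draws, and also that of a bad-event under a uniform
  permutation.\<close>

definition p :: real where
  "p = 1 / (real n * real (n - 1))"

definition events :: "event set" where
  "events = {B \<in> bad_events n M. fst (fst B) < fst (snd B)}"

text \<open>With the factor \<open>p\<close>, for a bad-event \<open>B\<close>, this is the expected
  value of \<open>f\<close> after \<open>B\<close> is resampled from \<open>\<pi>\<close>, and 0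
  where \<open>B\<close> is false.\<close>

definition A :: "event \<Rightarrow> ((nat \<Rightarrow> nat) \<Rightarrow> ennreal) \<Rightarrow> (nat \<Rightarrow> nat) \<Rightarrow> ennreal" where
  "A B f \<pi> = ennreal p * event_op n B f \<pi>"

abbreviation perms :: "(nat \<Rightarrow> nat) set" where
  "perms \<equiv> {\<pi>. \<pi> permutes {1..n}}"

lemma finite_color_class: "finite (color_class n M c)"
  by (rule finite_subset[of _ "{1..n} \<times> {1..n}"]) (auto simp: color_class_def)

lemma \<Delta>_pos: "\<Delta> \<ge> 1"
proof -
  have "(1, 1) \<in> color_class n M (M 1 1)" using n_pos by (simp add: color_class_def)
  then have "card (color_class n M (M 1 1)) \<noteq> 0" using finite_color_class by auto
  then show ?thesis using card_color[of "M 1 1"] by simp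
qed

lemma n_ge_2: "n \<ge> 2"
  using \<Delta>_le \<Delta>_pos by linarith

text \<open>Lowering \<Delta> and \<open>n\<close> by one takes 256 from the left side and only 27
  from the right. The ratio of the lowered numbers is what the line weight involves.\<close>

lemma \<Delta>_bound: "256 * (real \<Delta> - 1) \<le> 27 * (real n - 1)"
  using \<Delta>_le by simp

lemma p_nonneg: "0 \<le> p"
  by (simp add: p_def)

lemma p_normalized: "ennreal p * of_nat (n * (n - 1)) = 1"
proof -
  have "p * real (n * (n - 1)) = 1" using n_ge_2 by (simp add: p_def)
  then show ?thesis
    by (metis ennreal_1 ennreal_mult'' ennreal_of_nat_eq_real_of_nat of_nat_0_le_iff)
qed

lemma p_row: "ennreal p * of_nat (n - 1) = ennreal (1 / n)"
proof -
  have "p * real (n - 1) = 1 / n" using n_ge_2 by (simp add: p_def)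
  then show ?thesis
    by (metis ennreal_mult'' ennreal_of_nat_eq_real_of_nat of_nat_0_le_iff)
qed

lemma events_bad: "B \<in> events \<Longrightarrow> B \<in> bad_events n M"
  by (simp add: events_def)

lemma canon_events: "B \<in> bad_events n M \<Longrightarrow> canon B \<in> events"
  using canon_bad_events[of B n M] bad_eventsD(3)[of B n M] by (auto simp: events_def canon_def)

lemma finite_events: "finite events"
proof (rule finite_subset)
  show "events \<subseteq> ({1..n} \<times> {1..n}) \<times> ({1..n} \<times> {1..n})"
    by (auto simp: events_def bad_events_def)
qed simp

text \<open>A line has \<open>n\<close> cells, and each shares its color with at most
  \<open>\<Delta> - 1\<close> others. Since the cell on the line may be the second of its event,
  pairs are listed from that cell and then put in order by \<open>canon\<close>.\<close>

lemma card_events_line: "card {B \<in> events. l \<in> event_lines B} \<le> n * (\<Delta> - 1)"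
proof -
  define C where "C = {c \<in> {1..n} \<times> {1..n}. l \<in> cell_lines c}"
  define F where "F c = color_class n M (M (fst c) (snd c)) - {c}" for c
  have finF: "finite (F c)" for c using finite_color_class by (simp add: F_def)
  have "C \<subseteq> (case l of Inl x \<Rightarrow> Pair x ` {1..n} | Inr y \<Rightarrow> (\<lambda>x. (x, y)) ` {1..n})"
    by (auto simp: C_def cell_lines_def split: sum.split)
  then obtain g where g: "C \<subseteq> g ` {1..n}" by (metis sum.case_eq_if)
  have C: "finite C" "card C \<le> n"
    using finite_surj[OF _ g] surj_card_le[OF _ g] by simp_all
  have card_F: "card (F c) \<le> \<Delta> - 1" if "c \<in> C" for c
  proof -
    have "c \<in> color_class n M (M (fst c) (snd c))"
      using that by (auto simp: C_def color_class_def)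
    then show ?thesis
      using card_color[of "M (fst c) (snd c)"] by (simp add: F_def)
  qed
  have "{B \<in> events. l \<in> event_lines B} \<subseteq> canon ` Sigma C F"
  proof
    fix B assume "B \<in> {B \<in> events. l \<in> event_lines B}"
    then have B: "B \<in> bad_events n M" "fst (fst B) < fst (snd B)"
      and l: "l \<in> event_lines B" by (auto simp: events_def)
    have *: "c \<in> C \<and> d \<in> F c" if "(c, d) \<in> bad_events n M" "l \<in> cell_lines c" for c d
      using that by (auto simp: bad_events_def C_def F_def color_class_def)
    from l consider "l \<in> cell_lines (fst B)" | "l \<in> cell_lines (snd B)"
      by (auto simp: event_lines_def)
    then show "B \<in> canon ` Sigma C F"
    proof cases
      case 1
      then have "B \<in> Sigma C F" using *[of "fst B" "snd B"] B by (cases B) auto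
      then show ?thesis by (rule image_eqI[rotated]) (use B in \<open>simp add: canon_def\<close>)
    next
      case 2
      then have "prod.swap B \<in> Sigma C F"
        using *[of "snd B" "fst B"] bad_events_swap[OF B(1)] by (cases B) auto
      then show ?thesis by (rule image_eqI[rotated]) (use B in \<open>simp add: canon_def\<close>)
    qed
  qed
  then have "card {B \<in> events. l \<in> event_lines B} \<le> card (Sigma C F)"
    using C(1) finF by (meson card_image_le card_mono finite_SigmaI finite_imageI le_trans)
  also have "\<dots> = (\<Sum>c\<in>C. card (F c))" using C(1) finF by (simp add: card_SigmaI)
  also have "\<dots> \<le> card C * (\<Delta> - 1)" 
    using sum_bounded_above[of C "\<lambda>c. card (F c)"] card_F by simp
  also have "\<dots> \<le> n * (\<Delta> - 1)" using C(2) by simp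
  finally show ?thesis .
qed

text \<open>The count gives \<open>p * n * (\<Delta> - 1)\<close>, which is the ratio of
  \<open>\<Delta> - 1\<close> to \<open>n - 1\<close> and at most \<open>27 / 256\<close>;
  multiplied by \<open>256 / 81\<close> this is \<open>1 / 3\<close>.\<close>

lemma line_weight: "256 / 81 * p * card {B \<in> events. l \<in> event_lines B} \<le> 1 / 3"
proof -
  have "256 / 81 * p * card {B \<in> events. l \<in> event_lines B} \<le> 256 / 81 * p * (n * (\<Delta> - 1))"
    using card_events_line[of l] p_nonneg by (intro mult_left_mono) (auto simp flip: of_nat_mult)
  also have "\<dots> = 256 / 81 * (real \<Delta> - 1) / (real n - 1)"
    using n_ge_2 \<Delta>_pos by (simp add: p_def of_nat_diff)
  also have "\<dots> \<le> 1 / 3"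
    using \<Delta>_bound n_ge_2 by (simp add: divide_simps)
  finally show ?thesis .
qed

sublocale commuting_resampling events event_lines A perms p
proof
  show "finite events" by (rule finite_events)
  show "0 \<le> p" by (rule p_nonneg)
  fix B C f g and X :: "event set list set" and F :: "event set list \<Rightarrow> (nat \<Rightarrow> nat) \<Rightarrow> ennreal" and s
  show "event_lines B \<noteq> {}" "finite (event_lines B)"
    by (auto simp: event_lines_def cell_lines_def)
  show "card (event_lines B) \<le> 4"
    using card_length[of "[Inl (fst (fst B)), Inr (snd (fst B)), Inl (fst (snd B)), Inr (snd (snd B))]"]
    by (simp add: event_lines_def cell_lines_def insert_commute)
  show "A B (\<lambda>s. \<integral>\<^sup>+ r. F r s \<partial>count_space X) s = (\<integral>\<^sup>+ r. A B (F r) s \<partial>count_space X)"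
    by (simp add: A_def event_op_nn_integral nn_integral_cmult)
  show "256 / 81 * p * card {B \<in> events. l \<in> event_lines B} \<le> 1 / 3" for l
    by (rule line_weight)
  show "A B f \<le> A B g" if "f \<le> g"
    using event_op_mono[OF that, of n B] by (auto simp: A_def le_fun_def intro: mult_left_mono)
  assume B: "B \<in> events"
  show "A B (\<lambda>_. 1) \<le> (\<lambda>_. 1)"
    using p_normalized by (auto simp: le_fun_def A_def event_op_one[OF events_bad[OF B]] simp del: of_nat_mult)
  show "(\<Sum>s\<in>perms. A B f s) = ennreal p * (\<Sum>s\<in>perms. f s)"
    unfolding A_def by (subst sum_distrib_left[symmetric]) (simp only: event_op_sum_permutes[OF events_bad[OF B]])
  assume "C \<in> events" "disjnt (event_lines B) (event_lines C)"
  then show "A B (A C f) = A C (A B f)"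
    using event_op_commute[OF events_bad[OF B] events_bad, of C f]
    by (simp add: A_def[abs_def] event_op_cmult mult.left_commute)
qed

lemma A_one_holds: "B \<in> bad_events n M \<Longrightarrow> holds_on \<pi> B \<Longrightarrow> A B (\<lambda>_. 1) \<pi> = 1"
  using p_normalized by (simp add: A_def event_op_one del: of_nat_mult)

lemma A_add: "A B (\<lambda>\<pi>. f \<pi> + g \<pi>) \<pi> = A B f \<pi> + A B g \<pi>"
  by (simp add: A_def event_op_add distrib_left)

lemma A_cmult: "A B (\<lambda>\<pi>. k * f \<pi>) \<pi> = k * A B f \<pi>"
  by (simp add: A_def event_op_cmult mult.left_commute)

lemma A_sum_fun: "A B (\<lambda>\<pi>. \<Sum>i\<in>I. F i \<pi>) \<pi> = (\<Sum>i\<in>I. A B (F i) \<pi>)"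
  by (simp add: A_def event_op_sum sum_distrib_left)

lemma resample_nn_integral:
  assumes "B \<in> true_bad_events n M \<pi>"
  shows "(\<integral>\<^sup>+ \<pi>'. f \<pi>' \<partial>measure_spmf (resample n B \<pi>)) = A (canon B) f \<pi>"
proof -
  obtain x y x' y' where eq: "B = ((x, y), (x', y'))" by (metis surj_pair)
  have B: "B \<in> bad_events n M" "holds_on \<pi> B" using assms by (auto simp: true_bad_events_def)
  have x: "x \<in> {1..n}" using B(1) by (simp add: eq bad_events_def)
  let ?S = "\<lambda>a. \<Sum>b\<in>{1..n} - {x}. f (swap_values (swap_values \<pi> x a) x' b)"
  have inv: "inverse (of_nat (n - 1)) * inverse (of_nat n) = ennreal p"
    using n_ge_2
    by (simp add: p_def ennreal_of_nat_eq_real_of_nat inverse_ennreal flip: ennreal_mult'')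
      (simp add: divide_simps)
  have "(\<integral>\<^sup>+ \<pi>'. f \<pi>' \<partial>measure_spmf (resample n B \<pi>)) = (\<Sum>a\<in>{1..n}. ?S a / of_nat (n - 1)) / of_nat n"
    using x by (simp add: eq resample_def Let_def nn_integral_bind_spmf nn_integral_return_spmf
        nn_integral_spmf_of_set card_Diff_singleton)
  also have "\<dots> = (\<Sum>a\<in>{1..n}. ?S a) * (inverse (of_nat (n - 1)) * inverse (of_nat n))"
    by (simp add: divide_ennreal_def sum_distrib_right mult.assoc)
  also have "\<dots> = ennreal p * event_op n B f \<pi>"
    unfolding inv by (subst event_op_eq[OF B]) (simp add: eq mult.commute)
  also have "\<dots> = A (canon B) f \<pi>" by (simp add: A_def event_op_canon[OF B(1)])
  finally show ?thesis .
qed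

lemma lossless_resample:
  assumes "B \<in> bad_events n M"
  shows "lossless_spmf (resample n B \<pi>)"
proof -
  obtain x y x' y' where eq: "B = ((x, y), (x', y'))" by (metis surj_pair)
  have "x' \<in> {1..n} - {x}" using assms by (auto simp: eq bad_events_def)
  then have "{1..n} - {x} \<noteq> {}" "{1..n} \<noteq> {}" by blast+
  then show ?thesis by (simp add: eq resample_def Let_def del: Diff_eq_empty_iff)
qed

text \<open>The sum over \<open>D\<close> pays for the resamplings of events in \<open>D\<close>. It
  is used with all events, to count steps, and with the events that meet a line of a given
  cell.\<close>

lemma sum_potential_superharmonic:
  assumes "D \<subseteq> events" "C \<in> events" "holds_on \<pi> C"
  shows "(\<Sum>B\<in>D. A C (potential B) \<pi>) + (if C \<in> D then 1 else 0) \<le> (\<Sum>B\<in>D. potential B \<pi>)"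
proof -
  have fin: "finite D" using assms(1) finite_events finite_subset by blast
  have "(if C \<in> D then 1 else 0) = (\<Sum>B\<in>D. if C = B then A B (\<lambda>_. 1) \<pi> else 0)"
    using fin A_one_holds[OF events_bad[OF assms(2)] assms(3)] by simp
  then have "(\<Sum>B\<in>D. A C (potential B) \<pi>) + (if C \<in> D then 1 else 0) =
      (\<Sum>B\<in>D. A C (potential B) \<pi> + (if C = B then A B (\<lambda>_. 1) \<pi> else 0))"
    by (simp add: sum.distrib)
  also have "\<dots> \<le> (\<Sum>B\<in>D. potential B \<pi>)"
    using assms(1,2) by (intro sum_mono potential_superharmonic) auto
  finally show ?thesis .
qed

section \<open>The potential of a single cell\<close>

definition cell_events :: "cell \<Rightarrow> event set" where
  "cell_events e = {B \<in> events. \<not> disjnt (event_lines B) (cell_lines e)}"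

text \<open>
  Each resampling of an event that meets the row or the column of \<open>e\<close> makes \<open>e\<close> true with
  probability at most \<open>1/n\<close>, and no other resampling can make it true.
\<close>

definition cell_potential :: "cell \<Rightarrow> (nat \<Rightarrow> nat) \<Rightarrow> ennreal" where
  "cell_potential e \<pi> = cell_ind e \<pi> + ennreal (1 / n) * (\<Sum>B\<in>cell_events e. potential B \<pi>)"

lemma cell_potential_superharmonic:
  assumes \<pi>: "\<pi> permutes {1..n}" and e: "e \<in> {1..n} \<times> {1..n}"
    and C: "C \<in> events" "holds_on \<pi> C"
  shows "A C (cell_potential e) \<pi> \<le> cell_potential e \<pi>"
proof -
  have eq: "A C (cell_potential e) \<pi> =
      A C (cell_ind e) \<pi> + ennreal (1 / n) * (\<Sum>B\<in>cell_events e. A C (potential B) \<pi>)"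
    by (simp add: cell_potential_def[abs_def] A_add A_cmult A_sum_fun)
  have sub: "cell_events e \<subseteq> events" by (auto simp: cell_events_def)
  note super = sum_potential_superharmonic[OF sub C]
  show ?thesis
  proof (cases "C \<in> cell_events e")
    case True
    \<comment> \<open>The old value of \<open>cell_ind\<close> is given up. Its new expected value
      is at most \<open>1 / n\<close>, which the drop by one in the sum of potentials pays
      for.\<close>
    then have "A C (cell_ind e) \<pi> \<le> ennreal (1 / n)"
      using event_op_cell_ind_dependent[OF events_bad[OF C(1)] \<pi> e]
      unfolding p_row[symmetric] A_def cell_events_def by (auto intro: mult_left_mono)
    then have "A C (cell_potential e) \<pi> \<le>
        ennreal (1 / n) * ((\<Sum>B\<in>cell_events e. A C (potential B) \<pi>) + 1)"
      unfolding eq by (simp add: distrib_left add.commute add_left_mono)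
    also have "\<dots> \<le> ennreal (1 / n) * (\<Sum>B\<in>cell_events e. potential B \<pi>)"
      using super True by (intro mult_left_mono) auto
    also have "\<dots> \<le> cell_potential e \<pi>" by (simp add: cell_potential_def)
    finally show ?thesis .
  next
    case False
    then have "disjnt (event_lines C) (cell_lines e)" using C(1) by (simp add: cell_events_def)
    from event_op_cell_ind_independent[OF events_bad[OF C(1)] this]
    have "A C (cell_ind e) \<pi> \<le> ennreal p * (of_nat (n * (n - 1)) * cell_ind e \<pi>)"
      unfolding A_def by (rule mult_left_mono) simp
    also have "\<dots> = cell_ind e \<pi>"
      by (simp only: mult.assoc[symmetric] p_normalized mult_1)
    finally show ?thesis
      unfolding eq cell_potential_def using super False by (intro add_mono mult_left_mono) auto
  qed
qed

text \<open>Of the factor \<open>5 / 3\<close>, the initial permutation contributes 1, and the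
  events through the row and those through the column contribute at most \<open>1 / 3\<close>
  each.\<close>

lemma cell_potential_sum:
  assumes e: "e \<in> {1..n} \<times> {1..n}"
  shows "(\<Sum>\<pi>\<in>perms. cell_potential e \<pi>) \<le> ennreal (5 / 3 / n) * of_nat (card perms)"
proof -
  let ?K = "\<lambda>l. {B \<in> events. l \<in> event_lines B}"
  let ?N = "of_nat (card perms) :: ennreal"
  have "cell_events e = ?K (Inl (fst e)) \<union> ?K (Inr (snd e))"
    by (auto simp: cell_events_def cell_lines_def)
  then have "card (cell_events e) \<le> card (?K (Inl (fst e))) + card (?K (Inr (snd e)))"
    by (simp add: card_Un_le)
  then have "256 / 81 * p * card (cell_events e) \<le>
      256 / 81 * p * (card (?K (Inl (fst e))) + card (?K (Inr (snd e))))"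
    using p_nonneg by (intro mult_left_mono) (auto simp flip: of_nat_add)
  also have "\<dots> \<le> 2 / 3"
    using line_weight[of "Inl (fst e)"] line_weight[of "Inr (snd e)"] by (simp add: distrib_left)
  finally have card: "256 / 81 * p * card (cell_events e) \<le> 2 / 3" .
  have "(\<Sum>\<pi>\<in>perms. \<Sum>B\<in>cell_events e. potential B \<pi>) = (\<Sum>B\<in>cell_events e. \<Sum>\<pi>\<in>perms. potential B \<pi>)"
    by (rule sum.swap)
  also have "\<dots> \<le> (\<Sum>B\<in>cell_events e. ennreal (256 / 81 * p) * ?N)"
    by (intro sum_mono potential_sum) (simp add: cell_events_def)
  also have "\<dots> = ennreal (256 / 81 * p * card (cell_events e)) * ?N"
    by (simp only: sum_constant ennreal_mult''[OF of_nat_0_le_iff] ennreal_of_nat_eq_real_of_nat)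
      (simp only: mult_ac)
  also have "\<dots> \<le> ennreal (2 / 3) * ?N"
    using card by (intro mult_right_mono ennreal_leI) auto
  finally have pot: "(\<Sum>\<pi>\<in>perms. \<Sum>B\<in>cell_events e. potential B \<pi>) \<le> ennreal (2 / 3) * ?N" .
  have n: "ennreal (1 / n) * of_nat n = 1"
    using n_pos by (simp add: ennreal_of_nat_eq_real_of_nat flip: ennreal_mult'')
  have "(\<Sum>\<pi>\<in>perms. cell_ind e \<pi>) = ennreal (1 / n) * of_nat n * (\<Sum>\<pi>\<in>perms. cell_ind e \<pi>)"
    by (simp add: n)
  also have "\<dots> = ennreal (1 / n) * ?N"
    by (simp only: mult.assoc sum_cell_ind[OF e])
  finally have "(\<Sum>\<pi>\<in>perms. cell_potential e \<pi>) =
      ennreal (1 / n) * (?N + (\<Sum>\<pi>\<in>perms. \<Sum>B\<in>cell_events e. potential B \<pi>))"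
    by (simp add: cell_potential_def sum.distrib sum_distrib_left distrib_left)
  also have "\<dots> \<le> ennreal (1 / n) * (?N + ennreal (2 / 3) * ?N)"
    using pot by (intro mult_left_mono add_left_mono) auto
  also have "\<dots> = ennreal (1 / n) * (ennreal 1 + ennreal (2 / 3)) * ?N"
    by (simp add: distrib_left distrib_right mult.assoc)
  also have "\<dots> = ennreal (5 / 3 / n) * ?N"
    by (subst ennreal_plus[symmetric], simp, simp, subst ennreal_mult'[symmetric]) (auto simp: mult.commute)
  finally show ?thesis .
qed

end

section \<open>Termination and output distribution\<close>

lemma weight_selection:
  "weight w (selection n \<pi>) = (\<Sum>x\<in>{1..n}. w x (\<pi> x))"
proof -
  have "selection n \<pi> = (\<lambda>x. (x, \<pi> x)) ` {1..n}" by (auto simp: selection_def)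
  then show ?thesis by (simp add: weight_def sum.reindex inj_on_def)
qed

lemma ennreal_weight_selection:
  assumes \<pi>: "\<pi> permutes {1..n}" and nonneg: "\<And>x y. x \<in> {1..n} \<Longrightarrow> y \<in> {1..n} \<Longrightarrow> w x y \<ge> 0"
  shows "ennreal (weight w (selection n \<pi>)) =
    (\<Sum>x\<in>{1..n}. \<Sum>y\<in>{1..n}. ennreal (w x y) * indicator {\<pi>. \<pi> x = y} \<pi>)"
proof -
  have range: "\<pi> x \<in> {1..n}" if "x \<in> {1..n}" for x using that permutes_in_image[OF \<pi>] by simp
  have row: "(\<Sum>y\<in>{1..n}. ennreal (w x y) * indicator {\<pi>. \<pi> x = y} \<pi>) = ennreal (w x (\<pi> x))"
    if "x \<in> {1..n}" for x
  proof -
    have "(\<Sum>y\<in>{1..n}. ennreal (w x y) * indicator {\<pi>. \<pi> x = y} \<pi>) =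
        (\<Sum>y\<in>{1..n}. if y = \<pi> x then ennreal (w x y) else 0)"
      by (intro sum.cong refl) (auto split: split_indicator)
    then show ?thesis using range[OF that] by (simp del: One_nat_def)
  qed
  have "ennreal (weight w (selection n \<pi>)) = (\<Sum>x\<in>{1..n}. ennreal (w x (\<pi> x)))"
    unfolding weight_selection using range nonneg by (intro sum_ennreal[symmetric]) auto
  also have "\<dots> = (\<Sum>x\<in>{1..n}. \<Sum>y\<in>{1..n}. ennreal (w x y) * indicator {\<pi>. \<pi> x = y} \<pi>)"
    using row by (intro sum.cong refl) simp
  finally show ?thesis .
qed

lemma emeasure_bind_spmf:
  "emeasure (measure_spmf (bind_spmf p g)) X = (\<integral>\<^sup>+ x. emeasure (measure_spmf (g x)) X \<partial>measure_spmf p)"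
  using nn_integral_bind_spmf[where f = "indicator X"] by simp

context swapping
begin

lemma finite_perms: "finite perms" and perms_nonempty: "perms \<noteq> {}"
  using finite_permutations[OF finite_atLeastAtMost] permutes_id by blast+

text \<open>Optional stopping for a nonnegative supermartingale: \<open>\<Phi>\<close> does not
  increase in expectation at any step and dominates the indicator of \<open>X\<close> at the end.
  The bound holds for every history and every true event, hence for every rule. In the fixed point
  induction, unfinished runs contribute no mass.\<close>

lemma swapping_loop_emeasure_le:
  assumes R: "selection_rule n M R"
    and final: "\<And>\<pi>. \<pi> permutes {1..n} \<Longrightarrow> true_bad_events n M \<pi> = {} \<Longrightarrow> indicator X \<pi> \<le> \<Phi> \<pi>"
    and step: "\<And>\<pi> C. \<pi> permutes {1..n} \<Longrightarrow> C \<in> events \<Longrightarrow> holds_on \<pi> C \<Longrightarrow> A C \<Phi> \<pi> \<le> \<Phi> \<pi>"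
    and \<pi>: "\<pi> permutes {1..n}"
  shows "emeasure (measure_spmf (swapping_loop n M R h \<pi>)) X \<le> \<Phi> \<pi>"
proof -
  have "\<forall>h \<pi>. \<pi> permutes {1..n} \<longrightarrow> emeasure (measure_spmf (swapping_loop n M R h \<pi>)) X \<le> \<Phi> \<pi>"
  proof (induction rule: swapping_loop.fixp_induct)
    case 1
    show ?case unfolding curry_def
      by (intro admissible_all admissible_imp admissible_emeasure_spmf_le)
  next
    case 2
    show ?case by simp
  next
    case (3 loop)
    show ?case
    proof (intro allI impI)
      fix h \<pi> assume \<pi>: "\<pi> permutes {1..n}"
      let ?body = "if true_bad_events n M \<pi> = {} then return_spmf \<pi>
        else spmf_of_pmf (R h \<pi>) \<bind> (\<lambda>B. resample n B \<pi> \<bind> loop n M R ((\<pi>, B) # h))"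
      show "emeasure (measure_spmf ?body) X \<le> \<Phi> \<pi>"
      proof (cases "true_bad_events n M \<pi> = {}")
        case True
        then show ?thesis using final[OF \<pi>] by (simp add: measure_spmf_return_spmf)
      next
        case False
        have "emeasure (measure_spmf ?body) X = (\<integral>\<^sup>+ B. \<integral>\<^sup>+ \<pi>'. emeasure (measure_spmf (loop n M R ((\<pi>, B) # h) \<pi>')) X
            \<partial>measure_spmf (resample n B \<pi>) \<partial>measure_pmf (R h \<pi>))"
          using False by (simp add: emeasure_bind_spmf del: bind_spmf_of_pmf)
        also have "\<dots> \<le> (\<integral>\<^sup>+ B. \<Phi> \<pi> \<partial>measure_pmf (R h \<pi>))"
        proof (rule nn_integral_mono_AE, unfold AE_measure_pmf_iff, rule ballI)
          fix B assume "B \<in> set_pmf (R h \<pi>)"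
          then have B: "B \<in> true_bad_events n M \<pi>"
            using R \<pi> False by (auto simp: selection_rule_def)
          then have bad: "B \<in> bad_events n M" "holds_on \<pi> B" by (auto simp: true_bad_events_def)
          have "(\<integral>\<^sup>+ \<pi>'. emeasure (measure_spmf (loop n M R ((\<pi>, B) # h) \<pi>')) X \<partial>measure_spmf (resample n B \<pi>))
              \<le> (\<integral>\<^sup>+ \<pi>'. \<Phi> \<pi>' \<partial>measure_spmf (resample n B \<pi>))"
            using 3 resample_permutes[OF bad(1) \<pi>] by (intro nn_integral_mono_AE) simp
          also have "\<dots> = A (canon B) \<Phi> \<pi>" by (rule resample_nn_integral[OF B])
          also have "\<dots> \<le> \<Phi> \<pi>" using bad by (intro step \<pi> canon_events) simp_all
          finally show "(\<integral>\<^sup>+ \<pi>'. emeasure (measure_spmf (loop n M R ((\<pi>, B) # h) \<pi>')) X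
              \<partial>measure_spmf (resample n B \<pi>)) \<le> \<Phi> \<pi>" .
        qed
        also have "\<dots> = \<Phi> \<pi>" by simp
        finally show ?thesis .
      qed
    qed
  qed
  then show ?thesis using \<pi> by blast
qed

lemma swapping_loop_final:
  assumes R: "selection_rule n M R" and \<pi>: "\<pi> permutes {1..n}"
    and \<pi>': "\<pi>' \<in> set_spmf (swapping_loop n M R h \<pi>)"
  shows "\<pi>' permutes {1..n}" "true_bad_events n M \<pi>' = {}"
proof -
  \<comment> \<open>The improper outputs. Every \<open>A C\<close> preserves the zero function, and
    the indicator of this set vanishes at proper final permutations, so 0 is an admissible
    \<open>\<Phi>\<close>.\<close>
  let ?X = "- {\<pi>. \<pi> permutes {1..n} \<and> true_bad_events n M \<pi> = {}}"
  have "emeasure (measure_spmf (swapping_loop n M R h \<pi>)) ?X \<le> 0"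
    using swapping_loop_emeasure_le[OF R, of ?X "\<lambda>_. 0" \<pi> h] \<pi>
    by (simp add: A_def event_op_def cell_op_def)
  then have "measure (measure_spmf (swapping_loop n M R h \<pi>)) ?X = 0"
    by (simp add: measure_def)
  then have "\<pi>' \<notin> ?X" using \<pi>' by (auto simp: measure_spmf_zero_iff)
  then show "\<pi>' permutes {1..n}" "true_bad_events n M \<pi>' = {}" by auto
qed

text \<open>
  The total potential drops by at least one in every step, so it bounds the expected number of
  steps.
\<close>

lemma swapping_loop_None_le:
  assumes R: "selection_rule n M R" and "\<pi> permutes {1..n}"
  shows "of_nat k * ennreal (pmf (swapping_loop n M R h \<pi>) None) \<le> (\<Sum>B\<in>events. potential B \<pi>)"
  using assms(2)
proof (induction k arbitrary: h \<pi>)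
  case 0
  then show ?case by simp
next
  case (Suc k)
  note \<pi> = Suc.prems
  let ?\<Psi> = "\<lambda>\<pi>. \<Sum>B\<in>events. potential B \<pi>"
  show ?case
  proof (cases "true_bad_events n M \<pi> = {}")
    case True
    then show ?thesis by (subst swapping_loop.simps) simp
  next
    case False
    let ?q = "\<lambda>B \<pi>'. ennreal (pmf (swapping_loop n M R ((\<pi>, B) # h) \<pi>') None)"
    have support: "B \<in> true_bad_events n M \<pi>" if "B \<in> set_pmf (R h \<pi>)" for B
      using that R \<pi> False by (auto simp: selection_rule_def)
    have "ennreal (pmf (swapping_loop n M R h \<pi>) None) =
        (\<integral>\<^sup>+ B. ennreal (pmf (resample n B \<pi> \<bind> swapping_loop n M R ((\<pi>, B) # h)) None)
          \<partial>measure_pmf (R h \<pi>))"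
      using False by (subst swapping_loop.simps) (simp add: pmf_bind_spmf_None_lossless del: bind_spmf_of_pmf)
    also have "\<dots> = (\<integral>\<^sup>+ B. \<integral>\<^sup>+ \<pi>'. ?q B \<pi>' \<partial>measure_spmf (resample n B \<pi>) \<partial>measure_pmf (R h \<pi>))"
      using support
      by (intro nn_integral_cong_AE)
        (auto simp: AE_measure_pmf_iff true_bad_events_def
          intro!: pmf_bind_spmf_None_lossless lossless_resample)
    finally have "of_nat (Suc k) * ennreal (pmf (swapping_loop n M R h \<pi>) None) =
        (\<integral>\<^sup>+ B. of_nat (Suc k) * (\<integral>\<^sup>+ \<pi>'. ?q B \<pi>' \<partial>measure_spmf (resample n B \<pi>)) \<partial>measure_pmf (R h \<pi>))"
      by (simp add: nn_integral_cmult del: of_nat_Suc)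
    also have "\<dots> \<le> (\<integral>\<^sup>+ B. ?\<Psi> \<pi> \<partial>measure_pmf (R h \<pi>))"
    proof (rule nn_integral_mono_AE, unfold AE_measure_pmf_iff, rule ballI)
      fix B assume "B \<in> set_pmf (R h \<pi>)"
      then have B: "B \<in> true_bad_events n M \<pi>" by (rule support)
      then have bad: "B \<in> bad_events n M" "holds_on \<pi> B" by (auto simp: true_bad_events_def)
      let ?r = "measure_spmf (resample n B \<pi>)"
      \<comment> \<open>After the step, \<open>k\<close> copies of the missing mass are bounded by
        the induction hypothesis. The last copy is at most 1 and is paid for by the drop of the
        total potential.\<close>
      have "of_nat (Suc k) * (\<integral>\<^sup>+ \<pi>'. ?q B \<pi>' \<partial>?r) = (\<integral>\<^sup>+ \<pi>'. of_nat k * ?q B \<pi>' + ?q B \<pi>' \<partial>?r)"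
        by (simp add: nn_integral_add nn_integral_cmult distrib_right add.commute)
      also have "\<dots> \<le> (\<integral>\<^sup>+ \<pi>'. ?\<Psi> \<pi>' + 1 \<partial>?r)"
        using Suc.IH resample_permutes[OF bad(1) \<pi>]
        by (intro nn_integral_mono_AE) (auto intro!: add_mono simp: pmf_le_1)
      also have "\<dots> \<le> (\<integral>\<^sup>+ \<pi>'. ?\<Psi> \<pi>' \<partial>?r) + 1"
        by (subst nn_integral_add) (auto intro!: add_left_mono measure_spmf.emeasure_space_le_1)
      also have "\<dots> = (\<Sum>D\<in>events. A (canon B) (potential D) \<pi>) + 1"
        by (simp add: resample_nn_integral[OF B] A_sum_fun)
      also have "\<dots> \<le> ?\<Psi> \<pi>"
        using sum_potential_superharmonic[OF subset_refl canon_events[OF bad(1)], of \<pi>]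
          canon_events[OF bad(1)] bad(2) by simp
      finally show "of_nat (Suc k) * (\<integral>\<^sup>+ \<pi>'. ?q B \<pi>' \<partial>?r) \<le> ?\<Psi> \<pi>" .
    qed
    also have "\<dots> = ?\<Psi> \<pi>" by simp
    finally show ?thesis .
  qed
qed

text \<open>A finite sum over \<open>perms\<close> makes each potential finite at every permutation.
  Then every multiple of the missing mass lies below one real constant, so this mass is 0.\<close>

lemma lossless_swapping_loop:
  assumes R: "selection_rule n M R" and \<pi>: "\<pi> permutes {1..n}"
  shows "lossless_spmf (swapping_loop n M R h \<pi>)"
proof -
  have "(\<Sum>\<pi>\<in>perms. potential B \<pi>) < \<top>" if "B \<in> events" for B
    by (rule le_less_trans[OF potential_sum[OF that]]) (simp add: ennreal_mult_less_top of_nat_less_top)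
  then have "potential B \<pi> < \<top>" if "B \<in> events" for B
    using that \<pi> finite_perms by (auto simp: less_top)
  then have "(\<Sum>B\<in>events. potential B \<pi>) < \<top>"
    using finite_events by (simp add: less_top)
  then obtain r where r: "(\<Sum>B\<in>events. potential B \<pi>) = ennreal r" "r \<ge> 0"
    by (cases "\<Sum>B\<in>events. potential B \<pi>") auto
  have "real k * pmf (swapping_loop n M R h \<pi>) None \<le> r" for k
    using swapping_loop_None_le[OF R \<pi>, of k h] r
    by (simp add: ennreal_of_nat_eq_real_of_nat ennreal_le_iff flip: ennreal_mult'')
  then have "\<not> 0 < pmf (swapping_loop n M R h \<pi>) None"
    by (meson ex_less_of_nat_mult not_less)
  then show ?thesis
    using pmf_nonneg[of "swapping_loop n M R h \<pi>" None] by (simp add: lossless_iff_pmf_None)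
qed

lemma swapping_loop_cell_le:
  assumes R: "selection_rule n M R" and \<pi>: "\<pi> permutes {1..n}" and e: "(x, y) \<in> {1..n} \<times> {1..n}"
  shows "emeasure (measure_spmf (swapping_loop n M R h \<pi>)) {\<pi>. \<pi> x = y} \<le> cell_potential (x, y) \<pi>"
proof (rule swapping_loop_emeasure_le[OF R _ _ \<pi>])
  show "indicator {\<pi>. \<pi> x = y} \<pi>' \<le> cell_potential (x, y) \<pi>'" for \<pi>'
    by (auto simp: cell_potential_def cell_ind_def split: split_indicator)
qed (rule cell_potential_superharmonic[OF _ e])

section \<open>Latin transversals and the expected weight\<close>

lemma swapping_algorithm_latin:
  assumes R: "selection_rule n M R"
  shows "measure (measure_spmf (swapping_algorithm n M R)) {T. latin_transversal n M T} = 1"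
proof -
  let ?alg = "swapping_algorithm n M R"
  have lossless: "lossless_spmf ?alg"
    using finite_perms perms_nonempty lossless_swapping_loop[OF R] by (simp add: swapping_algorithm_def)
  have "latin_transversal n M T" if T: "T \<in> set_spmf ?alg" for T
  proof -
    obtain \<pi> \<pi>' where "\<pi> permutes {1..n}" "\<pi>' \<in> set_spmf (swapping_loop n M R [] \<pi>)" "T = selection n \<pi>'"
      using T finite_perms by (auto simp: swapping_algorithm_def set_bind_spmf)
    then show ?thesis
      using swapping_loop_final[OF R] latin_transversal_selection by blast
  qed
  then have "measure (measure_spmf ?alg) {T. latin_transversal n M T} = measure (measure_spmf ?alg) UNIV"
    by (intro measure_spmf.finite_measure_eq_AE) auto
  also have "\<dots> = 1" using lossless by (simp add: lossless_spmf_def weight_spmf_def)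
  finally show ?thesis .
qed

lemma expectation_MT_weight_le:
  assumes R: "selection_rule n M R"
    and nonneg: "\<And>x y. x \<in> {1..n} \<Longrightarrow> y \<in> {1..n} \<Longrightarrow> w x y \<ge> 0"
  shows "expectation_MT n M R (weight w) \<le> 5 / 3 * (\<Sum>x\<in>{1..n}. \<Sum>y\<in>{1..n}. w x y) / n"
  unfolding expectation_MT_def
proof (rule integral_real_bounded)
  let ?W = "\<Sum>x\<in>{1..n}. \<Sum>y\<in>{1..n}. w x y"
  let ?N = "card perms"
  note perms = finite_perms perms_nonempty
  then have N: "?N > 0" by (simp add: card_gt_0_iff)
  have W: "0 \<le> ?W" using nonneg by (intro sum_nonneg) auto
  then show "0 \<le> 5 / 3 * ?W / n" by simp
  \<comment> \<open>By linearity the weight splits over the cells. This bound is for a fixed initial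
    permutation; the factor \<open>5 / 3 / n\<close> appears only after averaging over the initial
    permutations, because \<open>cell_potential_sum\<close> controls just the mean.\<close>
  have loop: "(\<integral>\<^sup>+ \<pi>'. ennreal (weight w (selection n \<pi>')) \<partial>measure_spmf (swapping_loop n M R [] \<pi>)) \<le>
      (\<Sum>x\<in>{1..n}. \<Sum>y\<in>{1..n}. ennreal (w x y) * cell_potential (x, y) \<pi>)"
    if \<pi>: "\<pi> \<in> perms" for \<pi>
  proof -
    let ?L = "measure_spmf (swapping_loop n M R [] \<pi>)"
    have "(\<integral>\<^sup>+ \<pi>'. ennreal (weight w (selection n \<pi>')) \<partial>?L) =
        (\<integral>\<^sup>+ \<pi>'. (\<Sum>x\<in>{1..n}. \<Sum>y\<in>{1..n}. ennreal (w x y) * indicator {\<pi>. \<pi> x = y} \<pi>') \<partial>?L)"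
    proof (rule nn_integral_cong_AE, unfold AE_measure_spmf_iff, rule ballI)
      fix \<pi>' assume "\<pi>' \<in> set_spmf (swapping_loop n M R [] \<pi>)"
      then have "\<pi>' permutes {1..n}" using swapping_loop_final(1)[OF R] \<pi> by blast
      then show "ennreal (weight w (selection n \<pi>')) =
          (\<Sum>x\<in>{1..n}. \<Sum>y\<in>{1..n}. ennreal (w x y) * indicator {\<pi>. \<pi> x = y} \<pi>')"
        by (rule ennreal_weight_selection[OF _ nonneg])
    qed
    also have "\<dots> = (\<Sum>x\<in>{1..n}. \<Sum>y\<in>{1..n}. ennreal (w x y) * emeasure ?L {\<pi>. \<pi> x = y})"
      by (simp add: nn_integral_sum nn_integral_cmult_indicator del: sum_mult_indicator)
    also have "\<dots> \<le> (\<Sum>x\<in>{1..n}. \<Sum>y\<in>{1..n}. ennreal (w x y) * cell_potential (x, y) \<pi>)"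
      using \<pi> by (intro sum_mono mult_left_mono swapping_loop_cell_le R) auto
    finally show ?thesis .
  qed
  have "(\<integral>\<^sup>+ T. ennreal (weight w T) \<partial>measure_spmf (swapping_algorithm n M R)) =
      (\<Sum>\<pi>\<in>perms. \<integral>\<^sup>+ \<pi>'. ennreal (weight w (selection n \<pi>')) \<partial>measure_spmf (swapping_loop n M R [] \<pi>)) / ?N"
    by (simp add: swapping_algorithm_def nn_integral_bind_spmf nn_integral_return_spmf nn_integral_spmf_of_set)
  also have "\<dots> \<le> (\<Sum>\<pi>\<in>perms. \<Sum>x\<in>{1..n}. \<Sum>y\<in>{1..n}. ennreal (w x y) * cell_potential (x, y) \<pi>) / ?N"
    by (intro divide_right_mono_ennreal sum_mono loop)
  also have "(\<Sum>\<pi>\<in>perms. \<Sum>x\<in>{1..n}. \<Sum>y\<in>{1..n}. ennreal (w x y) * cell_potential (x, y) \<pi>) =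
      (\<Sum>x\<in>{1..n}. \<Sum>y\<in>{1..n}. ennreal (w x y) * (\<Sum>\<pi>\<in>perms. cell_potential (x, y) \<pi>))"
    by (simp only: sum.swap[of _ _ perms] sum_distrib_left)
  also have "\<dots> \<le> (\<Sum>x\<in>{1..n}. \<Sum>y\<in>{1..n}. ennreal (w x y) * (ennreal (5 / 3 / n) * of_nat ?N))"
    by (intro sum_mono mult_left_mono cell_potential_sum) auto
  also have "\<dots> = (\<Sum>x\<in>{1..n}. \<Sum>y\<in>{1..n}. ennreal (w x y)) * (ennreal (5 / 3 / n) * of_nat ?N)"
    by (simp only: sum_distrib_right)
  also have "(\<Sum>x\<in>{1..n}. \<Sum>y\<in>{1..n}. ennreal (w x y)) = ennreal ?W"
  proof -
    have "(\<Sum>x\<in>{1..n}. \<Sum>y\<in>{1..n}. ennreal (w x y)) = (\<Sum>x\<in>{1..n}. ennreal (\<Sum>y\<in>{1..n}. w x y))"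
      using nonneg by (intro sum.cong refl sum_ennreal) auto
    also have "\<dots> = ennreal ?W"
      using nonneg by (intro sum_ennreal sum_nonneg) auto
    finally show ?thesis .
  qed
  also have "ennreal ?W * (ennreal (5 / 3 / n) * of_nat ?N) = ennreal (?W * (5 / 3 / n)) * of_nat ?N"
  proof -
    have "ennreal (?W * (5 / 3 / n)) = ennreal ?W * ennreal (5 / 3 / n)"
      by (rule ennreal_mult'') simp
    then show ?thesis by (simp only: mult.assoc)
  qed
  also have "\<dots> / ?N = ennreal (?W * (5 / 3 / n))"
    using N by (simp add: ennreal_of_nat_eq_real_of_nat divide_ennreal_def mult.assoc
        inverse_ennreal flip: ennreal_mult'')
  also have "?W * (5 / 3 / n) = 5 / 3 * ?W / n" by simp
  finally show "(\<integral>\<^sup>+ T. ennreal (weight w T) \<partial>measure_spmf (swapping_algorithm n M R)) \<le> ennreal (5 / 3 * ?W / n)"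
    by (simp add: divide_right_mono_ennreal)
qed

end

theorem proposition8p1:
  fixes n \<Delta> :: nat
    and M :: "nat \<Rightarrow> nat \<Rightarrow> 'c"
    and w :: "nat \<Rightarrow> nat \<Rightarrow> real"
    and R :: rule
  assumes "n \<ge> 1"
    and "\<And>c. card (color_class n M c) \<le> \<Delta>"
    and "real \<Delta> \<le> 27 / 256 * real n"
    and "\<And>x y. x \<in> {1..n} \<Longrightarrow> y \<in> {1..n} \<Longrightarrow> w x y \<ge> 0"
    and "selection_rule n M R"
  shows "measure (measure_spmf (swapping_algorithm n M R)) {T. latin_transversal n M T} = 1 \<and>
         expectation_MT n M R (weight w)
           \<le> 5 / 3 * (\<Sum>x\<in>{1..n}. \<Sum>y\<in>{1..n}. w x y) / real n"
proof -
  interpret swapping n \<Delta> M using assms(1-3) by unfold_locales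
  show ?thesis
    using swapping_algorithm_latin[OF assms(5)] expectation_MT_weight_le[of R w] assms(4,5) by blast
qed

end
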